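(* For every integer $r\geq 3$ there exists $N\in\mathbb{N}$ such that for all integers $n\ge N$, $$\binom{r}{2}2^{n}-r^2+2r\leq g_r(\mathbb{Z}_n)\leq \binom{r}{2} 2^{n}+2^{-\frac{n}{36\log_2n}}2^n,$$ and thus all but an $o(1)$ proportion (as $n\to\infty$, $r$ fixed) of the rainbow 3-AP-free $r$-colorings of $\mathbb{Z}_n$ are 2-colorings (i.e. use at most two of the $r$ colors). Moreover, for all $n\ge N$ and every proper subset $A\subsetneq \mathbb{Z}_n$, we have $g_r(A, \mathbb{Z}_n)< g_r(\mathbb{Z}_n)$.
   Context: $\mathbb{Z}_n$ is the cyclic group $\{0,1,\ldots,n-1\}$ under addition modulo $n$. A 3-AP in $\mathbb{Z}_n$ is a sequence $a,b,c$ of elements of $\mathbb{Z}_n$ with $a+c\equiv 2b \pmod n$. For $A\subseteq\mathbb{Z}_n$, an $r$-coloring of $A$ is any map $A\to[r]=\{1,\dots,r\}$ (not necessarily surjective); it is rainbow 3-AP-free if there is no 3-AP in $\mathbb{Z}_n$ all of whose terms lie in $A$ and whose three terms have pairwise distinct colors. $g_r(A,\mathbb{Z}_n)$ is the number of rainbow 3-AP-free $r$-colorings of $A$, and $g_r(\mathbb{Z}_n)=g_r(\mathbb{Z}_n,\mathbb{Z}_n)$. *)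

theory Defs
  imports Complex_Main "HOL-Library.FuncSet" "HOL-Number_Theory.Cong"
begin

text \<open>Elements of the cyclic group of order \<open>n\<close> are represented by their least residues, and
  addition is expressed by congruence modulo \<open>n\<close>.\<close>

definition Zn :: "nat \<Rightarrow> nat set" where
  "Zn n = {0..<n}"

text \<open>Degenerate progressions are allowed: \<open>a\<close>, \<open>b\<close>, \<open>c\<close> need not be distinct.\<close>

definition three_AP :: "nat \<Rightarrow> nat \<Rightarrow> nat \<Rightarrow> nat \<Rightarrow> bool" where
  "three_AP n a b c \<longleftrightarrow>
     a \<in> Zn n \<and> b \<in> Zn n \<and> c \<in> Zn n \<and> [a + c = 2 * b] (mod n)"

definition rainbow_free :: "nat \<Rightarrow> nat set \<Rightarrow> (nat \<Rightarrow> nat) \<Rightarrow> bool" where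
  "rainbow_free n A f \<longleftrightarrow>
     \<not> (\<exists>a\<in>A. \<exists>b\<in>A. \<exists>c\<in>A.
          three_AP n a b c \<and> f a \<noteq> f b \<and> f b \<noteq> f c \<and> f a \<noteq> f c)"

text \<open>The extensional function space makes a coloring of \<open>A\<close> determined by its values on \<open>A\<close>,
  so that colorings can be counted with \<^const>\<open>card\<close>.\<close>

definition rainbow_free_colorings :: "nat \<Rightarrow> nat set \<Rightarrow> nat \<Rightarrow> (nat \<Rightarrow> nat) set" where
  "rainbow_free_colorings r A n = {f \<in> A \<rightarrow>\<^sub>E {1..r}. rainbow_free n A f}"

definition g :: "nat \<Rightarrow> nat set \<Rightarrow> nat \<Rightarrow> nat" where
  "g r A n = card (rainbow_free_colorings r A n)"

end

theory Submission
  imports Defs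
begin

text \<open>A colouring with at most two colours is trivially rainbow-free, so everything rests on bounding
  the colourings with at least three colours, for sets \<open>A\<close> that are nearly all of \<open>\<int>\<^sub>n\<close>, and all
  colourings of the remaining sets.

  If a family of colourings of \<open>A\<close> has more than about \<open>2\<^bsup>|A|\<^esup>\<close> members, then by a variant of the
  Sauer--Shelah lemma there are linearly many points of \<open>A\<close> and three colours at each of them such that
  all choices among these colours occur. By Roth's theorem these points contain a three-term
  progression, which some member of the family colours rainbow. This settles the sets \<open>A\<close> that miss a
  positive proportion of \<open>\<int>\<^sub>n\<close>. (Conversely, the claim for such sets implies Roth's theorem, because
  every colouring of a progression-free set is rainbow-free.)

  For the other sets let \<open>G\<close> be the smallest of \<open>t \<ge> 3\<close> large colour classes. Points outside \<open>G\<close> that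
  lie in a progression with a point of \<open>G\<close> have the same colour. If these equalities group all points
  outside \<open>G\<close> into classes of at least \<open>D\<close> points, then only \<open>(t - 1)\<^bsup>n/D\<^esup>\<close> colourings are left for \<open>G\<close>,
  and there are at most \<open>2\<^bsup>0.925 n\<^esup>\<close> sets \<open>G\<close> because \<open>|G| \<le> n/3\<close>. If a point \<open>u\<close> lies in a smaller
  class, then \<open>G\<close> is nearly symmetric about \<open>u\<close>, so that only about \<open>2\<^bsup>n/2\<^esup>\<close> sets \<open>G\<close> remain, while
  double counting bounds the number of such points by about \<open>|G| \<le> n/t\<close>; and
  \<open>(t - 1)\<^bsup>n/t\<^esup> \<le> 2\<^bsup>2n/5\<^esup>\<close>.\<close>

section \<open>Roth's theorem\<close>

definition apfree :: "nat set \<Rightarrow> bool" where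
  "apfree S \<longleftrightarrow> \<not> (\<exists>a d. d > 0 \<and> a \<in> S \<and> a + d \<in> S \<and> a + 2 * d \<in> S)"

lemma apfree_subset: "apfree S \<Longrightarrow> T \<subseteq> S \<Longrightarrow> apfree T"
  unfolding apfree_def by blast

lemma apfree_affine_vimage:
  assumes "apfree S" "q > 0"
  shows "apfree {i. w + i * q \<in> S}"
  unfolding apfree_def
proof clarify
  fix a d :: nat
  assume d: "0 < d" "w + a * q \<in> S" "w + (a + d) * q \<in> S" "w + (a + 2 * d) * q \<in> S"
  have "w + (a + d) * q = (w + a * q) + d * q" "w + (a + 2 * d) * q = (w + a * q) + 2 * (d * q)"
    by (simp_all add: algebra_simps)
  then show False
    using assms d unfolding apfree_def by (metis nat_0_less_mult_iff)
qed

text \<open>The additive constant \<open>M\<close> lets one bound serve all lengths and adds up over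
  disjoint pieces. The infimum of the nonnegative admissible \<open>\<kappa>\<close> is the limiting
  maximal density of progression-free sets.\<close>

definition density_bound :: "real \<Rightarrow> real \<Rightarrow> bool" where
  "density_bound \<kappa> M \<longleftrightarrow>
     (\<forall>l S. S \<subseteq> {..<l} \<and> apfree S \<longrightarrow> real (card S) \<le> \<kappa> * real l + M)"

text \<open>Blocks of length \<open>m\<close> are peeled off one by one, each at density
  \<open>\<kappa>\<close>; the incomplete last block has fewer than \<open>m\<close>
  elements.\<close>

lemma density_bound_of_scale:
  fixes \<kappa> :: real and m :: nat
  assumes "m > 0" "\<kappa> \<ge> 0"
    and m: "\<And>S. S \<subseteq> {..<m} \<Longrightarrow> apfree S \<Longrightarrow> real (card S) \<le> \<kappa> * m"
  shows "density_bound \<kappa> m"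
proof -
  have "\<forall>S. S \<subseteq> {..<l} \<and> apfree S \<longrightarrow> real (card S) \<le> \<kappa> * real l + m" for l
  proof (induction l rule: less_induct)
    case (less l)
    show ?case
    proof (intro allI impI, elim conjE)
      fix S :: "nat set"
      assume S: "S \<subseteq> {..<l}" "apfree S"
      show "real (card S) \<le> \<kappa> * real l + m"
      proof (cases "l < m")
        case True
        have "card S \<le> l" using card_mono[OF _ S(1)] by simp
        then have "real (card S) \<le> m" using True by linarith
        then show ?thesis using \<open>\<kappa> \<ge> 0\<close> by (simp add: add_increasing)
      next
        case False
        let ?U = "{i. m + i * 1 \<in> S}"
        have U: "?U \<subseteq> {..<l - m}" using S(1) by auto
        have "apfree ?U" using apfree_affine_vimage[OF S(2), of 1 m] by simp
        then have 1: "real (card ?U) \<le> \<kappa> * real (l - m) + m"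
          using less.IH[of "l - m"] U False \<open>m > 0\<close> by auto
        have 2: "real (card (S \<inter> {..<m})) \<le> \<kappa> * m"
          using m[of "S \<inter> {..<m}"] apfree_subset[OF S(2)] by auto
        have "S \<subseteq> (S \<inter> {..<m}) \<union> (\<lambda>i. m + i) ` ?U"
        proof
          fix x assume "x \<in> S"
          then show "x \<in> (S \<inter> {..<m}) \<union> (\<lambda>i. m + i) ` ?U"
            by (cases "x < m") (auto intro!: image_eqI[of _ _ "x - m"])
        qed
        moreover have fU: "finite ?U" using U finite_subset by blast
        ultimately have "card S \<le> card ((S \<inter> {..<m}) \<union> (\<lambda>i. m + i) ` ?U)"
          using S(1) finite_subset by (intro card_mono) auto
        also have "\<dots> \<le> card (S \<inter> {..<m}) + card ?U"
          using card_Un_le[of "S \<inter> {..<m}"] card_image_le[OF fU, of "\<lambda>i. m + i"]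
          by (meson add_left_mono le_trans)
        finally have "real (card S) \<le> \<kappa> * m + (\<kappa> * real (l - m) + m)"
          using 1 2 by linarith
        then show ?thesis using False by (simp add: algebra_simps of_nat_diff)
      qed
    qed
  qed
  then show ?thesis unfolding density_bound_def by blast
qed

text \<open>Affine maps carry progressions to progressions, so a bound for initial segments holds on
  every arithmetic progression, whatever its difference.\<close>

lemma density_bound_progression:
  assumes "density_bound \<kappa> M" "apfree S" "q > 0"
  shows "real (card (S \<inter> (\<lambda>i. w + i * q) ` {..<l})) \<le> \<kappa> * l + M"
proof -
  let ?U = "{i. w + i * q \<in> S} \<inter> {..<l}"
  have "S \<inter> (\<lambda>i. w + i * q) ` {..<l} = (\<lambda>i. w + i * q) ` ?U" by auto
  then have "card (S \<inter> (\<lambda>i. w + i * q) ` {..<l}) \<le> card ?U"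
    using card_image_le[of ?U "\<lambda>i. w + i * q"] by simp
  moreover have "apfree ?U"
    using apfree_subset[OF apfree_affine_vimage[OF assms(2,3), of w], of ?U] by auto
  ultimately show ?thesis
    using assms(1) unfolding density_bound_def
    by (smt (verit) Int_lower2 of_nat_mono)
qed

lemma density_bound_interval:
  assumes "density_bound \<kappa> M" "apfree S"
  shows "real (card (S \<inter> {s..<s + l})) \<le> \<kappa> * l + M"
proof -
  have "{s..<s + l} = (\<lambda>i. s + i * 1) ` {..<l}"
    by (simp add: lessThan_atLeast0 add.commute)
  then show ?thesis using density_bound_progression[OF assms, of 1 s l] by simp
qed

text \<open>A set with few elements that are not preceded, at distance \<open>q\<close>, by another element splits
  into few maximal progressions of difference \<open>q\<close>.\<close>

lemma density_bound_runs:
  assumes "density_bound \<kappa> M" "apfree S" "q > 0" "finite W"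
  shows "real (card (S \<inter> W)) \<le> \<kappa> * card W + M * card {w \<in> W. \<forall>v\<in>W. w \<noteq> v + q}"
  using \<open>finite W\<close>
proof (induction "card W" arbitrary: W rule: less_induct)
  case less
  show ?case
  proof (cases "W = {}")
    case True
    then show ?thesis by simp
  next
    case False
    define w where "w = Min W"
    have w: "w \<in> W" "\<And>v. v \<in> W \<Longrightarrow> w \<le> v"
      using False less.prems by (auto simp: w_def)
    have "\<exists>l. w + l * q \<notin> W"
    proof (rule ccontr)
      assume "\<not> ?thesis"
      then have "range (\<lambda>l. w + l * q) \<subseteq> W" by auto
      moreover have "inj (\<lambda>l. w + l * q)" using \<open>q > 0\<close> by (auto simp: inj_def)
      ultimately show False
        using less.prems by (meson finite_subset infinite_UNIV_nat finite_imageD)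
    qed
    then obtain l where l: "w + l * q \<notin> W" "\<And>j. j < l \<Longrightarrow> w + j * q \<in> W"
      using exists_least_iff[of "\<lambda>l. w + l * q \<notin> W"] by blast
    then have "l > 0" using w(1) by (cases l) auto
    define run where "run = (\<lambda>i. w + i * q) ` {..<l}"
    have run: "run \<subseteq> W" using l(2) by (auto simp: run_def)
    have card_run: "card run = l"
      unfolding run_def using \<open>q > 0\<close> by (subst card_image) (auto simp: inj_on_def)
    have "w \<in> run" using \<open>l > 0\<close> by (auto simp: run_def intro!: image_eqI[of _ _ 0])
    define V where "V = W - run"
    let ?st = "\<lambda>W. {w \<in> W. \<forall>v\<in>W. w \<noteq> v + q}"
    have "card V < card W" unfolding V_def
      using \<open>w \<in> run\<close> w(1) less.prems by (intro psubset_card_mono) auto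
    moreover have fV: "finite V" using less.prems by (simp add: V_def)
    ultimately have IH: "real (card (S \<inter> V)) \<le> \<kappa> * card V + M * card (?st V)"
      using less.hyps by blast
    \<comment> \<open>The maximal progression \<open>run\<close> from the least element uses up
      exactly one start: its other members have a predecessor in \<open>W\<close>, and removing it
      creates no new start because it stops only where \<open>W\<close> does.\<close>
    have "?st W = insert w (?st V)"
    proof (intro equalityI subsetI)
      fix x assume x: "x \<in> ?st W"
      show "x \<in> insert w (?st V)"
      proof (cases "x \<in> run")
        case True
        then obtain i where i: "x = w + i * q" "i < l" by (auto simp: run_def)
        show ?thesis
        proof (cases i)
          case (Suc j)
          then have "x = (w + j * q) + q" "w + j * q \<in> W" using i l(2) by auto
          then show ?thesis using x by blast
        qed (use i in simp)
      next
        case False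
        then show ?thesis using x by (auto simp: V_def)
      qed
    next
      fix x assume x: "x \<in> insert w (?st V)"
      show "x \<in> ?st W"
      proof (cases "x = w")
        case True
        have "w \<noteq> v + q" if "v \<in> W" for v using w(2)[OF that] \<open>q > 0\<close> by simp
        then show ?thesis using True w(1) by simp
      next
        case False
        then have x: "x \<in> V" "\<And>v. v \<in> V \<Longrightarrow> x \<noteq> v + q" using x by auto
        have "x \<noteq> v + q" if v: "v \<in> run" for v
        proof
          assume "x = v + q"
          from v obtain i where i: "v = w + i * q" "i < l" by (auto simp: run_def)
          have e: "x = w + Suc i * q" using \<open>x = v + q\<close> i by simp
          show False
          proof (cases "Suc i < l")
            case True
            then have "x \<in> run"
              unfolding run_def e by (intro image_eqI[of _ _ "Suc i"]) auto
            then show False using x(1) by (simp add: V_def)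
          next
            case False
            then have "Suc i = l" using i by simp
            then show False using l(1) x(1) e by (auto simp: V_def)
          qed
        qed
        then show ?thesis using x by (auto simp: V_def)
      qed
    qed
    moreover have "w \<notin> ?st V" using \<open>w \<in> run\<close> by (simp add: V_def)
    ultimately have st: "card (?st W) = Suc (card (?st V))"
      using fV by simp
    have cW: "card W = card V + l"
      using card_run run less.prems card_Diff_subset[of run W] card_mono[of W run] finite_subset[OF run]
      by (simp add: V_def)
    have "S \<inter> W = (S \<inter> V) \<union> (S \<inter> run)" using run by (auto simp: V_def)
    then have "card (S \<inter> W) \<le> card (S \<inter> V) + card (S \<inter> run)"
      by (simp add: card_Un_le)
    moreover have "real (card (S \<inter> run)) \<le> \<kappa> * l + M"
      unfolding run_def by (rule density_bound_progression[OF assms(1-3)])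
    ultimately have "real (card (S \<inter> W)) \<le> \<kappa> * card V + M * card (?st V) + (\<kappa> * l + M)"
      using IH by linarith
    then show ?thesis unfolding st cW by (simp add: algebra_simps)
  qed
qed

section \<open>Hilbert cubes in dense sets\<close>

fun cube :: "nat \<Rightarrow> nat list \<Rightarrow> nat set" where
  "cube b [] = {b}"
| "cube b (d # ds) = cube b ds \<union> (\<lambda>x. x + d) ` cube b ds"

lemma base_in_cube: "b \<in> cube b ds"
  by (induction ds) auto

text \<open>Elements of \<open>B\<close> without another element of \<open>B\<close> in the next
  \<open>h\<close> places lie more than \<open>h\<close> apart, so there are at most
  \<open>p / h + 1\<close> of them. The others share the differences up to \<open>h\<close>, one of
  which is popular by pigeonhole. That \<open>h\<close> does not depend on \<open>p\<close> keeps
  the shifts in the proof of Roth's theorem bounded.\<close>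

lemma popular_difference:
  fixes \<beta> :: real
  assumes "\<beta> > 0"
  shows "\<exists>h \<beta>' P. \<beta>' > 0 \<and> (\<forall>p\<ge>P. \<forall>s B. B \<subseteq> {s..<s + p} \<longrightarrow> real (card B) \<ge> \<beta> * p \<longrightarrow>
           (\<exists>d\<in>{1..h::nat}. real (card {b \<in> B. b + d \<in> B}) \<ge> \<beta>' * real (p::nat)))"
proof -
  define h where "h = Suc (nat \<lceil>2 / \<beta>\<rceil>)"
  have h: "real h \<ge> 2 / \<beta>" "h > 0" unfolding h_def by linarith+
  \<comment> \<open>With \<open>h \<ge> 2 / \<beta>\<close> the isolated elements take at most half
    of \<open>\<beta> * p\<close>, plus one. The factor 8 leaves an eighth for all differences
    together, and \<open>\<beta> * p \<ge> 4\<close> absorbs the one.\<close>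
  define \<beta>' where "\<beta>' = \<beta> / (8 * h)"
  define P where "P = nat \<lceil>4 / \<beta>\<rceil> + 1"
  have "\<beta>' > 0" using assms h by (simp add: \<beta>'_def)
  moreover have "\<exists>d\<in>{1..h}. real (card {b \<in> B. b + d \<in> B}) \<ge> \<beta>' * p"
    if p: "p \<ge> P" and B: "B \<subseteq> {s..<s + p}" and cB: "real (card B) \<ge> \<beta> * p" for p s B
  proof (rule ccontr)
    assume "\<not> ?thesis"
    then have small: "\<And>d. d \<in> {1..h} \<Longrightarrow> real (card {b \<in> B. b + d \<in> B}) \<le> \<beta>' * p"
      by force
    have fB: "finite B" using B finite_subset by blast
    define bad where "bad = {b \<in> B. \<forall>d\<in>{1..h}. b + d \<notin> B}"
    have bp: "\<beta> * p \<ge> 4"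
    proof -
      have "real p \<ge> 4 / \<beta>" using p unfolding P_def by linarith
      then show ?thesis using assms by (simp add: field_simps)
    qed
    have sep: "y > x + h" if "x \<in> bad" "y \<in> bad" "x < y" for x y
    proof (rule ccontr)
      assume "\<not> y > x + h"
      then have "y - x \<in> {1..h}" "x + (y - x) = y" using that by auto
      then show False using that unfolding bad_def by (metis (mono_tags, lifting) mem_Collect_eq)
    qed
    have "inj_on (\<lambda>(b, i). b + i) (bad \<times> {..<h})"
    proof (rule inj_onI, clarify)
      fix b i b' i' :: nat
      assume a: "b \<in> bad" "b' \<in> bad" "i < h" "i' < h" "b + i = b' + i'"
      have "\<not> b < b'" "\<not> b' < b" using sep a by fastforce+
      then show "b = b' \<and> i = i'" using a by simp
    qed
    moreover have "(\<lambda>(b, i). b + i) ` (bad \<times> {..<h}) \<subseteq> {s..<s + (p + h)}"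
      using B by (fastforce simp: bad_def)
    ultimately have "card (bad \<times> {..<h}) \<le> card {s..<s + (p + h)}"
      by (intro card_inj_on_le[of "\<lambda>(b, i). b + i"]) auto
    then have "real (card bad * h) \<le> real (p + h)"
      by (simp only: of_nat_le_iff card_cartesian_product card_lessThan card_atLeastLessThan add_diff_cancel_left')
    then have bad: "real (card bad) \<le> p / h + 1" using h by (simp add: field_simps)
    have "B \<subseteq> bad \<union> (\<Union>d\<in>{1..h}. {b \<in> B. b + d \<in> B})" by (auto simp: bad_def)
    then have "card B \<le> card (bad \<union> (\<Union>d\<in>{1..h}. {b \<in> B. b + d \<in> B}))"
      using fB by (intro card_mono) (auto simp: bad_def)
    also have "\<dots> \<le> card bad + (\<Sum>d\<in>{1..h}. card {b \<in> B. b + d \<in> B})"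
      using card_Un_le[of bad "\<Union>d\<in>{1..h}. {b \<in> B. b + d \<in> B}"]
        card_UN_le[of "{1..h}" "\<lambda>d. {b \<in> B. b + d \<in> B}"] by simp
    finally have "real (card B) \<le> real (card bad) + (\<Sum>d\<in>{1..h}. real (card {b \<in> B. b + d \<in> B}))"
      by (simp flip: of_nat_add of_nat_sum)
    also have "\<dots> \<le> (p / h + 1) + (\<Sum>d\<in>{1..h}. \<beta>' * p)"
      by (intro add_mono bad sum_mono small)
    also have "(\<Sum>d\<in>{1..h}. \<beta>' * real p) = \<beta> * p / 8" using h by (simp add: \<beta>'_def)
    finally have 1: "\<beta> * p \<le> p / h + 1 + \<beta> * p / 8" using cB by linarith
    have "real p / h \<le> \<beta> * p / 2"
      using h assms mult_right_mono[of "2 / \<beta>" "real h" "real p * \<beta>"] by (simp add: field_simps)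
    then show False using 1 bp by linarith
  qed
  ultimately show ?thesis by blast
qed

text \<open>Hilbert's cube lemma with bounded generators: a cube among the \<open>b\<close> for
  which \<open>b\<close> and \<open>b + d\<close> lie in \<open>B\<close> extends by the generator
  \<open>d\<close> to a cube in \<open>B\<close>. Each round keeps a positive density.\<close>

lemma cube_in_dense_set:
  "\<beta> > 0 \<Longrightarrow> \<exists>H P. \<forall>p\<ge>P. \<forall>s B. B \<subseteq> {s..<s + p} \<longrightarrow> real (card B) \<ge> \<beta> * real p \<longrightarrow>
     (\<exists>b ds. length ds = k \<and> set ds \<subseteq> {1..H} \<and> cube b ds \<subseteq> B)"
proof (induction k arbitrary: \<beta>)
  case 0
  have "\<exists>b ds. length ds = 0 \<and> set ds \<subseteq> {1..0} \<and> cube b ds \<subseteq> B"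
    if "p \<ge> 1" "real (card B) \<ge> \<beta> * real p" for p and B :: "nat set"
  proof -
    have "real (card B) > 0" using that \<open>\<beta> > 0\<close> by (smt (verit) mult_pos_pos of_nat_1 of_nat_mono)
    then obtain b where "b \<in> B" by (metis card.empty equals0I less_irrefl of_nat_0)
    then show ?thesis by (intro exI[of _ b] exI[of _ "[]"]) simp
  qed
  then have "\<forall>p\<ge>1. \<forall>s B. B \<subseteq> {s..<s + p} \<longrightarrow> real (card B) \<ge> \<beta> * real p \<longrightarrow>
     (\<exists>b ds. length ds = 0 \<and> set ds \<subseteq> {1..0} \<and> cube b ds \<subseteq> B)" by simp
  then show ?case by (intro exI)
next
  case (Suc k)
  from popular_difference[OF Suc.prems] obtain h \<beta>' P1 where \<beta>': "\<beta>' > 0" and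
    h: "\<forall>p\<ge>P1. \<forall>s B. B \<subseteq> {s..<s + p} \<longrightarrow> real (card B) \<ge> \<beta> * p \<longrightarrow>
           (\<exists>d\<in>{1..h}. real (card {b \<in> B. b + d \<in> B}) \<ge> \<beta>' * real p)"
    by (elim exE conjE)
  from Suc.IH[OF \<beta>'] obtain H P2 where
    H: "\<forall>p\<ge>P2. \<forall>s B. B \<subseteq> {s..<s + p} \<longrightarrow> real (card B) \<ge> \<beta>' * real p \<longrightarrow>
     (\<exists>b ds. length ds = k \<and> set ds \<subseteq> {1..H} \<and> cube b ds \<subseteq> B)"
    by (elim exE)
  have "\<exists>b ds. length ds = Suc k \<and> set ds \<subseteq> {1..max h H} \<and> cube b ds \<subseteq> B"
    if p: "p \<ge> max P1 P2" "B \<subseteq> {s..<s + p}" "real (card B) \<ge> \<beta> * real p" for p s B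
  proof -
    obtain d where d: "d \<in> {1..h}" "real (card {b \<in> B. b + d \<in> B}) \<ge> \<beta>' * real p"
      using h[rule_format, of p B s] p by auto
    have sub: "{b \<in> B. b + d \<in> B} \<subseteq> {s..<s + p}" using p(2) by blast
    obtain b ds where b: "length ds = k" "set ds \<subseteq> {1..H}" "cube b ds \<subseteq> {b \<in> B. b + d \<in> B}"
      using H[rule_format, OF _ sub d(2)] p(1) by auto
    have "set (d # ds) \<subseteq> {1..max h H}" using b(2) d(1) by (auto simp: le_max_iff_disj)
    moreover have "cube b (d # ds) \<subseteq> B" using b(3) by auto
    ultimately show ?thesis using b(1) by (metis length_Cons)
  qed
  then have "\<forall>p\<ge>max P1 P2. \<forall>s B. B \<subseteq> {s..<s + p} \<longrightarrow> real (card B) \<ge> \<beta> * real p \<longrightarrow>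
     (\<exists>b ds. length ds = Suc k \<and> set ds \<subseteq> {1..max h H} \<and> cube b ds \<subseteq> B)" by simp
  then show ?case by (intro exI)
qed

text \<open>Truncated subtraction does no harm: this is only used when \<open>X\<close> lies below \<open>b\<close>.\<close>

definition third_terms :: "nat set \<Rightarrow> nat \<Rightarrow> nat list \<Rightarrow> nat set" where
  "third_terms X b ds = (\<lambda>(x, y). 2 * y - x) ` (X \<times> cube b ds)"

text \<open>Moving the middle term by \<open>d\<close> moves the third term by \<open>2 * d\<close>.
  The hypothesis rules out truncation in \<open>2 * y - x\<close>.\<close>

lemma third_terms_Cons:
  assumes "\<And>x. x \<in> X \<Longrightarrow> x \<le> b"
  shows "third_terms X b (d # ds) = third_terms X b ds \<union> (\<lambda>z. z + 2 * d) ` third_terms X b ds"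
proof -
  have ge: "b \<le> y" if "y \<in> cube b ds" for y
    using that by (induction ds arbitrary: y) (auto, fastforce)
  have *: "2 * (y + d) - x = 2 * y - x + 2 * d" if "x \<in> X" "y \<in> cube b ds" for x y
    using assms[OF that(1)] ge[OF that(2)] by simp
  have mem: "z \<in> third_terms X b ds \<longleftrightarrow> (\<exists>x\<in>X. \<exists>y\<in>cube b ds. z = 2 * y - x)" for z ds
    by (auto simp: third_terms_def)
  show ?thesis
  proof (rule set_eqI)
    fix z
    have "z \<in> third_terms X b (d # ds) \<longleftrightarrow>
        (\<exists>x\<in>X. \<exists>y\<in>cube b ds. z = 2 * y - x \<or> z = 2 * (y + d) - x)"
      unfolding mem by (simp add: bex_Un bex_disj_distrib)
    also have "\<dots> \<longleftrightarrow> (\<exists>x\<in>X. \<exists>y\<in>cube b ds. z = 2 * y - x \<or> z = 2 * y - x + 2 * d)"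
      using * by (simp cong: bex_cong)
    also have "\<dots> \<longleftrightarrow> z \<in> third_terms X b ds \<union> (\<lambda>z. z + 2 * d) ` third_terms X b ds"
    proof -
      have "(\<exists>w\<in>third_terms X b ds. z = w + 2 * d) \<longleftrightarrow>
          (\<exists>x\<in>X. \<exists>y\<in>cube b ds. z = 2 * y - x + 2 * d)"
        by (auto simp: third_terms_def)
      then show ?thesis by (simp add: image_iff mem[of z] bex_disj_distrib)
    qed
    finally show "z \<in> third_terms X b (d # ds) \<longleftrightarrow>
      z \<in> third_terms X b ds \<union> (\<lambda>z. z + 2 * d) ` third_terms X b ds" .
  qed
qed

text \<open>Pigeonhole over the generators: by \<open>third_terms_Cons\<close> each one adds exactly
  the new elements of a translate. If all added more than \<open>\<tau>\<close>, the final set would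
  be too large.\<close>

lemma almost_invariant_third_terms:
  fixes \<tau> :: real
  assumes "\<And>x. x \<in> X \<Longrightarrow> x \<le> b" "finite X"
    and "real (card (third_terms X b ds)) \<le> \<tau> * length ds" "ds \<noteq> []"
  shows "\<exists>ys d zs. ds = ys @ d # zs \<and>
    real (card ((\<lambda>z. z + 2 * d) ` third_terms X b zs - third_terms X b zs)) \<le> \<tau>"
  using assms(3,4)
proof (induction ds)
  case (Cons d ds)
  have fin: "finite (third_terms X b ds)" for ds
  proof -
    have "finite (cube b ds)" by (induction ds) auto
    then show ?thesis unfolding third_terms_def using \<open>finite X\<close> by blast
  qed
  let ?T = "third_terms X b ds" and ?N = "(\<lambda>z. z + 2 * d) ` third_terms X b ds - third_terms X b ds"
  show ?case
  proof (cases "real (card ?N) \<le> \<tau>")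
    case True
    then show ?thesis by (intro exI[of _ "[]"]) auto
  next
    case False
    have "third_terms X b (d # ds) = ?T \<union> ?N"
      using third_terms_Cons[OF assms(1)] by blast
    moreover have "card (?T \<union> ?N) = card ?T + card ?N"
      by (rule card_Un_disjoint) (use fin in auto)
    ultimately have split: "card (third_terms X b (d # ds)) = card ?T + card ?N" by metis
    then have le: "real (card ?T) \<le> \<tau> * length ds" using False Cons.prems(1)
      by (simp add: algebra_simps)
    show ?thesis
    proof (cases "ds = []")
      case True
      then have "\<tau> * real (length (d # ds)) = \<tau>" by simp
      then show ?thesis using False Cons.prems(1) split by linarith
    next
      case False
      then obtain ys d' zs where "ds = ys @ d' # zs"
        "real (card ((\<lambda>z. z + 2 * d') ` third_terms X b zs - third_terms X b zs)) \<le> \<tau>"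
        using Cons.IH le by blast
      then show ?thesis by (intro exI[of _ "d # ys"]) auto
    qed
  qed
qed simp

lemma cube_suffix: "cube b zs \<subseteq> cube b (ys @ zs)"
  by (induction ys) auto

text \<open>The third terms of progressions from \<open>X\<close> through a Hilbert cube in
  \<open>B\<close> avoid \<open>A\<close> and fill a positive proportion of the interval, and for
  some subcube they are almost invariant under a bounded shift. Their complement then splits into
  few progressions, on which \<open>A\<close> has density hardly above \<open>c\<close>; so
  \<open>A\<close> has too few elements.\<close>

lemma no_positive_density:
  fixes c :: real
  assumes "c > 0" "c \<le> 1"
    and lower: "\<And>n::nat. n > 0 \<Longrightarrow> \<exists>S. S \<subseteq> {..<n} \<and> apfree S \<and> real (card S) \<ge> c * n"
    and upper: "\<And>\<epsilon>. \<epsilon> > 0 \<Longrightarrow> \<exists>M. density_bound (c + \<epsilon>) M"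
  shows False
proof -
  \<comment> \<open>Confining \<open>A\<close> to the complement gains
    \<open>c\<^sup>2 * p / 2\<close>. The losses \<open>4 * \<epsilon> * p\<close>,
    \<open>2 * M * H\<close> and \<open>4 * M * p / k\<close> will each be at most a quarter of
    that.\<close>
  define \<epsilon> where "\<epsilon> = c\<^sup>2 / 32"
  have "c * c \<le> c" using \<open>c > 0\<close> \<open>c \<le> 1\<close> by (simp add: mult_left_le)
  then have \<epsilon>: "\<epsilon> > 0" "12 * \<epsilon> \<le> c"
    using \<open>c > 0\<close> by (auto simp: \<epsilon>_def power2_eq_square)
  obtain M where M: "density_bound (c + \<epsilon>) M" using upper[OF \<epsilon>(1)] by blast
  have "M \<ge> 0" using M[unfolded density_bound_def, rule_format, of "{}" 0]
    by (simp add: apfree_def)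
  define k where "k = nat \<lceil>32 * M / c\<^sup>2\<rceil> + 1"
  have k: "real k \<ge> 32 * M / c\<^sup>2" "k > 0" unfolding k_def by linarith+
  have "c / 2 > 0" using \<open>c > 0\<close> by simp
  from cube_in_dense_set[OF this, of k] obtain H P where
    H: "\<forall>p\<ge>P. \<forall>s B. B \<subseteq> {s..<s + p} \<longrightarrow> real (card B) \<ge> c / 2 * real p \<longrightarrow>
     (\<exists>b ds. length ds = k \<and> set ds \<subseteq> {1..H} \<and> cube b ds \<subseteq> B)"
    by (elim exE)
  define p where "p = P + nat \<lceil>8 * M / c\<rceil> + nat \<lceil>16 * M * H / c\<^sup>2\<rceil> + 1"
  have p: "p \<ge> P" "p > 0" "real p \<ge> 8 * M / c" "real p \<ge> 16 * M * H / c\<^sup>2"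
    unfolding p_def by linarith+
  have p3: "c * p \<ge> 8 * M" using p(3) \<open>c > 0\<close> by (simp add: field_simps)
  have p4: "c\<^sup>2 * p \<ge> 16 * M * H" using p(4) \<open>c > 0\<close> by (simp add: field_simps)
  \<comment> \<open>Four blocks of length \<open>p\<close> suffice: a third term
    \<open>2 * y - x\<close> with \<open>y < 2 * p\<close> stays below \<open>4 * p\<close>.\<close>
  obtain A where A: "A \<subseteq> {..<4 * p}" "apfree A" "real (card A) \<ge> c * real (4 * p)"
    using lower[of "4 * p"] p(2) by auto
  have fA: "finite A" using A(1) finite_subset by blast
  have cint: "real (card (A \<inter> {s..<s + l})) \<le> (c + \<epsilon>) * l + M" for s l
    by (rule density_bound_interval[OF M A(2)])
  define X where "X = A \<inter> {..<p}"
  define B where "B = A \<inter> {p..<p + p}"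
  have ep: "12 * \<epsilon> * p \<le> c * p" using \<epsilon>(2) by (simp add: mult_right_mono)
  \<comment> \<open>No interval is denser than \<open>c + \<epsilon>\<close>, up to
    \<open>M\<close>, so neither of the first two blocks can be much sparser than
    \<open>c\<close>.\<close>
  have X: "real (card X) \<ge> c / 2 * p"
  proof -
    have "A = X \<union> (A \<inter> {p..<p + 3 * p})" using A(1) by (auto simp: X_def)
    then have "card A \<le> card X + card (A \<inter> {p..<p + 3 * p})" by (metis card_Un_le)
    then have "real (card A) \<le> real (card X) + ((c + \<epsilon>) * real (3 * p) + M)"
      using cint[of p "3 * p"] by linarith
    then show ?thesis using A(3) ep p3 \<open>M \<ge> 0\<close> by (simp add: algebra_simps)
  qed
  have B: "real (card B) \<ge> c / 2 * p"
  proof -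
    have "A = B \<union> (A \<inter> {0..<0 + p}) \<union> (A \<inter> {2 * p..<2 * p + 2 * p})" using A(1) by (auto simp: B_def)
    then have "card A \<le> card (B \<union> (A \<inter> {0..<0 + p})) + card (A \<inter> {2 * p..<2 * p + 2 * p})"
      by (metis card_Un_le)
    then have "card A \<le> card B + card (A \<inter> {0..<0 + p}) + card (A \<inter> {2 * p..<2 * p + 2 * p})"
      using card_Un_le[of B "A \<inter> {0..<0 + p}"] by linarith
    then have "real (card A) \<le> real (card B) + ((c + \<epsilon>) * real p + M) + ((c + \<epsilon>) * real (2 * p) + M)"
      using cint[of 0 p] cint[of "2 * p" "2 * p"] by linarith
    then show ?thesis using A(3) ep p3 by (simp add: algebra_simps)
  qed
  obtain b ds where ds: "length ds = k" "set ds \<subseteq> {1..H}" "cube b ds \<subseteq> B"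
    using H[rule_format, OF p(1) _ B, of p] by (auto simp: B_def)
  have bp: "p \<le> b" using base_in_cube[of b ds] ds(3) by (auto simp: B_def)
  have Xb: "\<And>x. x \<in> X \<Longrightarrow> x \<le> b" using bp by (auto simp: X_def)
  have range: "third_terms X b zs \<subseteq> {..<4 * p} - A" if "cube b zs \<subseteq> B" for zs
  proof
    fix z assume "z \<in> third_terms X b zs"
    then obtain x y where xy: "x \<in> X" "y \<in> cube b zs" "z = 2 * y - x"
      unfolding third_terms_def by auto
    then have "y \<in> B" using that by blast
    then have *: "x \<in> A" "y \<in> A" "x < p" "p \<le> y" "y < p + p" using xy(1) by (auto simp: X_def B_def)
    then have "x + (y - x) = y" "x + 2 * (y - x) = z" "y - x > 0" using xy(3) by auto
    then have "z \<notin> A" using * A(2) unfolding apfree_def by metis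
    then show "z \<in> {..<4 * p} - A" using * xy(3) by auto
  qed
  have "card (third_terms X b ds) \<le> card {..<4 * p}"
    using range[OF ds(3)] by (intro card_mono) auto
  then have "real (card (third_terms X b ds)) \<le> (4 * p / k) * length ds"
    using ds(1) k(2) by simp
  then obtain ys d zs where dz: "ds = ys @ d # zs"
    "real (card ((\<lambda>z. z + 2 * d) ` third_terms X b zs - third_terms X b zs)) \<le> 4 * p / k"
    using almost_invariant_third_terms[of X b ds "4 * p / k"] Xb ds(1) k(2) fA
    by (force simp: X_def)
  define E where "E = third_terms X b zs"
  have "cube b zs \<subseteq> B" using ds(3) cube_suffix[of b zs "ys @ [d]"] dz(1) by auto
  then have E: "E \<subseteq> {..<4 * p} - A" using range by (simp add: E_def)
  have fE: "finite E" using E finite_subset by blast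
  have d: "1 \<le> d" "d \<le> H" using ds(2) dz(1) by auto
  have cE: "card X \<le> card E"
  proof (rule card_inj_on_le[of "\<lambda>x. 2 * b - x"])
    show "inj_on (\<lambda>x. 2 * b - x) X"
    proof (rule inj_onI)
      fix x y assume "x \<in> X" "y \<in> X" "2 * b - x = 2 * b - y"
      then show "x = y" using Xb[of x] Xb[of y] by linarith
    qed
    have "2 * b - x \<in> E" if "x \<in> X" for x
      unfolding E_def third_terms_def
      using that base_in_cube[of b zs] by (intro image_eqI[of _ _ "(x, b)"]) auto
    then show "(\<lambda>x. 2 * b - x) ` X \<subseteq> E" by blast
  qed (rule fE)
  define W where "W = {..<4 * p} - E"
  have fW: "finite W" by (simp add: W_def)
  have "A \<inter> W = A" using A(1) E by (auto simp: W_def)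
  then have 1: "real (card A) \<le> (c + \<epsilon>) * card W + M * card {w \<in> W. \<forall>v\<in>W. w \<noteq> v + 2 * d}"
    using density_bound_runs[OF M A(2) _ fW, of "2 * d"] d(1) by simp
  have cW: "real (card W) \<le> 4 * p - c / 2 * p"
  proof -
    have "card W = card {..<4 * p} - card E"
      unfolding W_def using E fE by (intro card_Diff_subset) auto
    moreover have "card E \<le> card {..<4 * p}" using E by (intro card_mono) auto
    ultimately show ?thesis using cE X by simp
  qed
  \<comment> \<open>A start in \<open>W\<close> either lies below \<open>2 * d\<close> or has its
    predecessor in \<open>E\<close>; in the second case it is one of the few points by which the
    shift leaves \<open>E\<close>.\<close>
  have "{w \<in> W. \<forall>v\<in>W. w \<noteq> v + 2 * d} \<subseteq> {..<2 * d} \<union> ((\<lambda>z. z + 2 * d) ` E - E)"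
  proof
    fix w assume w: "w \<in> {w \<in> W. \<forall>v\<in>W. w \<noteq> v + 2 * d}"
    show "w \<in> {..<2 * d} \<union> ((\<lambda>z. z + 2 * d) ` E - E)"
    proof (cases "w < 2 * d")
      case False
      then have e: "w = (w - 2 * d) + 2 * d" by simp
      then have "w - 2 * d \<notin> W" using w by blast
      then have "w - 2 * d \<in> E" using w by (auto simp: W_def)
      then show ?thesis using e w by (auto simp: W_def)
    qed simp
  qed
  then have "card {w \<in> W. \<forall>v\<in>W. w \<noteq> v + 2 * d} \<le> card ({..<2 * d} \<union> ((\<lambda>z. z + 2 * d) ` E - E))"
    using fE by (intro card_mono) auto
  also have "\<dots> \<le> 2 * d + card ((\<lambda>z. z + 2 * d) ` E - E)"
    using card_Un_le[of "{..<2 * d}"] by simp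
  finally have 2: "real (card {w \<in> W. \<forall>v\<in>W. w \<noteq> v + 2 * d}) \<le> 2 * H + 4 * p / k"
    using dz(2) d(2) unfolding E_def by linarith
  have "c * (4 * p) \<le> (c + \<epsilon>) * (4 * p - c / 2 * p) + M * (2 * H + 4 * p / k)"
  proof -
    have "(c + \<epsilon>) * card W \<le> (c + \<epsilon>) * (4 * p - c / 2 * p)"
      using cW \<open>c > 0\<close> \<epsilon>(1) by (intro mult_left_mono) auto
    moreover have "M * card {w \<in> W. \<forall>v\<in>W. w \<noteq> v + 2 * d} \<le> M * (2 * H + 4 * p / k)"
      using 2 \<open>M \<ge> 0\<close> by (rule mult_left_mono)
    ultimately show ?thesis using 1 A(3) by simp
  qed
  also have "\<dots> = c * (4 * p) - c\<^sup>2 * p / 2 + \<epsilon> * (4 * p) - \<epsilon> * (c / 2 * p) + 2 * M * H + p * (4 * M / k)"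
    by (simp add: algebra_simps power2_eq_square)
  also have "\<dots> \<le> c * (4 * p) - c\<^sup>2 * p / 2 + c\<^sup>2 * p / 8 + c\<^sup>2 * p / 8 + p * (c\<^sup>2 / 8)"
  proof -
    have "4 * M / k \<le> c\<^sup>2 / 8" using k \<open>c > 0\<close> by (simp add: field_simps)
    then have "p * (4 * M / k) \<le> p * (c\<^sup>2 / 8)" by (intro mult_left_mono) auto
    moreover have "\<epsilon> * (c / 2 * p) \<ge> 0" using \<epsilon>(1) \<open>c > 0\<close> by simp
    moreover have "\<epsilon> * (4 * p) = c\<^sup>2 * p / 8" by (simp add: \<epsilon>_def)
    ultimately show ?thesis using p4 by linarith
  qed
  also have "\<dots> = c * (4 * p) - c\<^sup>2 * p / 8" by (simp add: algebra_simps)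
  finally have "c\<^sup>2 * p \<le> 0" by simp
  moreover have "c\<^sup>2 * p > 0" using \<open>c > 0\<close> p(2) by simp
  ultimately show False by linarith
qed

text \<open>If the infimum \<open>c\<close> of all admissible densities were positive, it would
  satisfy both hypotheses of \<open>no_positive_density\<close>.\<close>

theorem Roth:
  fixes \<delta> :: real
  assumes "\<delta> > 0"
  shows "\<exists>N::nat. \<forall>n\<ge>N. \<forall>S. S \<subseteq> {..<n} \<and> apfree S \<longrightarrow> real (card S) < \<delta> * n"
proof -
  define D where "D = {\<kappa>. 0 \<le> \<kappa> \<and> (\<exists>M. density_bound \<kappa> M)}"
  define c where "c = Inf D"
  have "1 \<in> D" unfolding D_def density_bound_def
  proof (intro CollectI conjI exI[of _ 0] allI impI)
    fix l S assume "S \<subseteq> {..<l} \<and> apfree S"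
    then show "real (card S) \<le> 1 * real l + 0" using card_mono[of "{..<l}" S] by simp
  qed simp
  have bdd: "bdd_below D" by (rule bdd_belowI[of _ 0]) (simp add: D_def)
  have c: "0 \<le> c" "c \<le> 1" unfolding c_def
    using \<open>1 \<in> D\<close> bdd by (auto intro!: cInf_greatest cInf_lower simp: D_def)
  have up: "\<exists>M. density_bound (c + \<epsilon>) M" if "\<epsilon> > 0" for \<epsilon>
  proof -
    have "D \<noteq> {}" "Inf D < c + \<epsilon>" using \<open>1 \<in> D\<close> that by (auto simp: c_def)
    from cInf_lessD[OF this] obtain \<kappa> where "\<kappa> \<in> D" "\<kappa> < c + \<epsilon>" by (elim bexE)
    then obtain M where M: "density_bound \<kappa> M" by (auto simp: D_def)
    have "density_bound (c + \<epsilon>) M" unfolding density_bound_def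
    proof (intro allI impI)
      fix l S assume "S \<subseteq> {..<l} \<and> apfree S"
      then have "real (card S) \<le> \<kappa> * l + M" using M unfolding density_bound_def by blast
      moreover have "\<kappa> * l \<le> (c + \<epsilon>) * l" using \<open>\<kappa> < c + \<epsilon>\<close> by (intro mult_right_mono) auto
      ultimately show "real (card S) \<le> (c + \<epsilon>) * real l + M" by linarith
    qed
    then show ?thesis by blast
  qed
  have "c = 0"
  proof (rule ccontr)
    assume "c \<noteq> 0"
    then have "c > 0" using c by simp
    \<comment> \<open>If all progression-free sets in some \<open>{..<n}\<close> had fewer than
      \<open>c * n\<close> elements, cutting into blocks of that length would give an admissible
      density below the infimum.\<close>
    have "\<exists>S. S \<subseteq> {..<n} \<and> apfree S \<and> real (card S) \<ge> c * n" if "n > 0" for n :: nat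
    proof (rule ccontr)
      assume no: "\<not> ?thesis"
      define F where "F = {S. S \<subseteq> {..<n} \<and> apfree S}"
      have fF: "finite F" unfolding F_def by (rule finite_subset[of _ "Pow {..<n}"]) auto
      have "{} \<in> F" by (auto simp: F_def apfree_def)
      define m where "m = Max ((\<lambda>S. real (card S)) ` F)"
      have m: "m \<in> (\<lambda>S. real (card S)) ` F" "\<And>S. S \<in> F \<Longrightarrow> real (card S) \<le> m"
        unfolding m_def using fF \<open>{} \<in> F\<close> by (auto intro!: Max_in)
      then have "m < c * n" "0 \<le> m" using no by (force simp: F_def)+
      have "density_bound (m / n) n"
        by (rule density_bound_of_scale) (use m that \<open>0 \<le> m\<close> in \<open>auto simp: F_def\<close>)
      then have "m / n \<in> D" using \<open>0 \<le> m\<close> by (auto simp: D_def)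
      then have "c \<le> m / n" unfolding c_def using bdd by (rule cInf_lower)
      then show False using \<open>m < c * n\<close> that by (simp add: field_simps)
    qed
    then show False using no_positive_density[OF \<open>c > 0\<close> c(2)] up by blast
  qed
  then obtain M where M: "density_bound (\<delta> / 2) M" using up[of "\<delta> / 2"] assms by auto
  define N where "N = nat \<lceil>2 * M / \<delta>\<rceil> + 1"
  have "real (card S) < \<delta> * n" if "n \<ge> N" "S \<subseteq> {..<n}" "apfree S" for n S
  proof -
    have "real (card S) \<le> \<delta> / 2 * n + M" using M that unfolding density_bound_def by blast
    moreover have "real n > 2 * M / \<delta>" using that(1) unfolding N_def by linarith
    then have "M < \<delta> / 2 * n" using assms by (simp add: field_simps)
    ultimately show ?thesis by linarith
  qed
  then show ?thesis by blast
qed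

section \<open>Shattering with three colours\<close>

text \<open>The three colours may vary from point to point: any three triples still have distinct
  representatives, which is all that a rainbow progression needs.\<close>

definition triple_shatters :: "('a \<Rightarrow> 'c) set \<Rightarrow> 'a set \<Rightarrow> 'c set \<Rightarrow> nat \<Rightarrow> bool" where
  "triple_shatters F A C d \<longleftrightarrow>
     (\<exists>S P. S \<subseteq> A \<and> card S = d \<and> (\<forall>s\<in>S. P s \<subseteq> C \<and> card (P s) = 3) \<and>
       (\<forall>h. (\<forall>s\<in>S. h s \<in> P s) \<longrightarrow> (\<exists>f\<in>F. \<forall>s\<in>S. f s = h s)))"

lemma triple_shatters_0: "F \<noteq> {} \<Longrightarrow> triple_shatters F A C 0"
  unfolding triple_shatters_def by (intro exI[of _ "{}"]) auto

lemma card_le_two_plus_triples: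
  assumes "finite X"
  shows "card X \<le> 2 + card {P. P \<subseteq> X \<and> card P = 3}"
proof -
  have "n \<le> 2 + (n choose 3)" for n :: nat
  proof (induction n)
    case (Suc n)
    show ?case
    proof (cases "n \<ge> 2")
      case True
      then have "n choose 2 \<ge> 1" by (simp add: Suc_leI)
      then show ?thesis using Suc by (simp add: numeral_3_eq_3 numeral_2_eq_2)
    next
      case False
      then show ?thesis by linarith
    qed
  qed simp
  then show ?thesis using n_subsets[OF assms, of 3] by simp
qed

text \<open>Splitting a family at a point \<open>a\<close>: a function on the remaining points with
  \<open>k\<close> extensions is counted twice in the projection and, since \<open>k \<le> 2 + (k choose 3)\<close>, once for
  every triple of values that it admits at \<open>a\<close>.\<close>

lemma card_le_if_not_triple_shatters:
  fixes x :: real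
  assumes "finite A" "finite C" "0 < x" "x \<le> 1"
    and q: "q = card {P. P \<subseteq> C \<and> card P = 3}" "q \<ge> 1"
    and "F \<subseteq> A \<rightarrow>\<^sub>E C" "\<not> triple_shatters F A C d"
  shows "real (card F) \<le> (2 + x) ^ card A * (q / x) ^ d"
  using assms(1,7,8)
proof (induction A arbitrary: F d rule: finite_induct)
  case empty
  show ?case
  proof (cases "F = {}")
    case False
    have "real (card F) \<le> 1" using card_mono[OF _ empty.prems(1)] by simp
    moreover have "1 \<le> q / x" using q(2) assms(3,4) by simp
    then have "1 \<le> (q / x) ^ d" by (rule one_le_power)
    ultimately show ?thesis by simp
  qed (use assms(3) in simp)
next
  case (insert a A)
  have fPi: "finite (A \<rightarrow>\<^sub>E C)" "finite (insert a A \<rightarrow>\<^sub>E C)"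
    using insert.hyps(1) \<open>finite C\<close> by (auto intro!: finite_PiE)
  show ?case
  proof (cases "F = {}")
    case True
    then show ?thesis using assms(3) by simp
  next
    case False
    then have "d \<noteq> 0" using triple_shatters_0[of F] insert.prems(2) by (metis (full_types))
    then obtain e where d: "d = Suc e" by (cases d) auto
    define fib where "fib h = {c \<in> C. h(a := c) \<in> F}" for h
    define H where "H = {h \<in> A \<rightarrow>\<^sub>E C. fib h \<noteq> {}}"
    define T where "T = {P. P \<subseteq> C \<and> card P = 3}"
    define G where "G P = {h \<in> H. P \<subseteq> fib h}" for P
    have fin: "finite H" "finite T" "\<And>h. finite (fib h)"
      using fPi \<open>finite C\<close> by (auto simp: H_def T_def fib_def)
    have "F \<subseteq> (\<lambda>(h, c). h(a := c)) ` Sigma H fib"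
    proof
      fix f assume f: "f \<in> F"
      then have fE: "f \<in> insert a A \<rightarrow>\<^sub>E C" using insert.prems(1) by blast
      let ?h = "restrict f A"
      have e: "?h(a := f a) = f"
      proof
        fix y show "(?h(a := f a)) y = f y"
          using PiE_arb[OF fE, of y] by (cases "y = a"; cases "y \<in> A") auto
      qed
      have "f a \<in> fib ?h" using f fE by (auto simp: fib_def e simp del: fun_upd_restrict)
      moreover have "?h \<in> H" using calculation fE by (auto simp: H_def)
      ultimately show "f \<in> (\<lambda>(h, c). h(a := c)) ` Sigma H fib"
        using e by (intro image_eqI[of _ _ "(?h, f a)"]) auto
    qed
    then have "card F \<le> card (Sigma H fib)"
      using fin by (meson card_image_le card_mono finite_SigmaI finite_imageI le_trans)
    also have "\<dots> = (\<Sum>h\<in>H. card (fib h))" using fin by (intro card_SigmaI) auto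
    also have "\<dots> \<le> (\<Sum>h\<in>H. 2 + card {P \<in> T. P \<subseteq> fib h})"
    proof (rule sum_mono)
      fix h
      have "{P. P \<subseteq> fib h \<and> card P = 3} = {P \<in> T. P \<subseteq> fib h}"
        by (auto simp: T_def fib_def)
      then show "card (fib h) \<le> 2 + card {P \<in> T. P \<subseteq> fib h}"
        using card_le_two_plus_triples[OF fin(3), of h] by simp
    qed
    also have "\<dots> = 2 * card H + (\<Sum>h\<in>H. card {P \<in> T. P \<subseteq> fib h})"
      by (simp only: sum.distrib) simp
    also have "(\<Sum>h\<in>H. card {P \<in> T. P \<subseteq> fib h}) = (\<Sum>P\<in>T. card (G P))"
      by (rule sum_multicount_gen) (use fin in \<open>auto simp: G_def\<close>)
    finally have "card F \<le> 2 * card H + (\<Sum>P\<in>T. card (G P))" .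
    then have 1: "real (card F) \<le> 2 * real (card H) + (\<Sum>P\<in>T. real (card (G P)))"
      by (simp flip: of_nat_sum)
    have "\<not> triple_shatters H A C d"
    proof
      assume "triple_shatters H A C d"
      then obtain S P where SP: "S \<subseteq> A" "card S = d" "\<forall>s\<in>S. P s \<subseteq> C \<and> card (P s) = 3"
        "\<forall>h. (\<forall>s\<in>S. h s \<in> P s) \<longrightarrow> (\<exists>f\<in>H. \<forall>s\<in>S. f s = h s)"
        unfolding triple_shatters_def by blast
      have "\<exists>f\<in>F. \<forall>s\<in>S. f s = h s" if h: "\<forall>s\<in>S. h s \<in> P s" for h
      proof -
        obtain f where f: "f \<in> H" "\<forall>s\<in>S. f s = h s" using SP(4) h by blast
        then obtain c where "c \<in> fib f" by (auto simp: H_def)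
        then have "f(a := c) \<in> F" by (simp add: fib_def)
        moreover have "\<forall>s\<in>S. (f(a := c)) s = h s" using f(2) SP(1) insert.hyps(2) by auto
        ultimately show ?thesis by blast
      qed
      then have "triple_shatters F (insert a A) C d"
        unfolding triple_shatters_def using SP(1-3) by blast
      then show False using insert.prems(2) by blast
    qed
    then have 2: "real (card H) \<le> (2 + x) ^ card A * (q / x) ^ d"
      by (intro insert.IH) (auto simp: H_def)
    \<comment> \<open>If \<open>G Q\<close> shattered \<open>e\<close> points, then these together
      with \<open>a\<close> and its triple \<open>Q\<close> would be shattered by
      \<open>F\<close>.\<close>
    have 3: "real (card (G Q)) \<le> (2 + x) ^ card A * (q / x) ^ e" if Q: "Q \<in> T" for Q
    proof (rule insert.IH)
      show "\<not> triple_shatters (G Q) A C e"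
      proof
        assume "triple_shatters (G Q) A C e"
        then obtain S P where SP: "S \<subseteq> A" "card S = e" "\<forall>s\<in>S. P s \<subseteq> C \<and> card (P s) = 3"
          "\<forall>h. (\<forall>s\<in>S. h s \<in> P s) \<longrightarrow> (\<exists>f\<in>G Q. \<forall>s\<in>S. f s = h s)"
          unfolding triple_shatters_def by blast
        define P' where "P' = P(a := Q)"
        have aS: "a \<notin> S" "finite S" using SP(1) insert.hyps finite_subset by auto
        have "\<exists>f\<in>F. \<forall>s\<in>insert a S. f s = h s" if h: "\<forall>s\<in>insert a S. h s \<in> P' s" for h
        proof -
          have "\<forall>s\<in>S. h s \<in> P s"
          proof
            fix s assume "s \<in> S"
            then show "h s \<in> P s" using h aS by (auto simp: P'_def split: if_splits)
          qed
          then obtain f where f: "f \<in> G Q" "\<forall>s\<in>S. f s = h s" using SP(4) by blast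
          have "h a \<in> Q" using h by (simp add: P'_def)
          then have "f(a := h a) \<in> F" using f(1) by (auto simp: G_def fib_def)
          moreover have "\<forall>s\<in>insert a S. (f(a := h a)) s = h s" using f(2) aS by auto
          ultimately show ?thesis by blast
        qed
        moreover have "\<forall>s\<in>insert a S. P' s \<subseteq> C \<and> card (P' s) = 3"
          using SP(3) Q by (auto simp: P'_def T_def)
        moreover have "insert a S \<subseteq> insert a A" "card (insert a S) = d" using SP aS d by auto
        ultimately have "triple_shatters F (insert a A) C d"
          unfolding triple_shatters_def by blast
        then show False using insert.prems(2) by blast
      qed
    qed (auto simp: G_def H_def)
    have "(\<Sum>P\<in>T. real (card (G P))) \<le> (\<Sum>P\<in>T. (2 + x) ^ card A * (q / x) ^ e)"
      by (rule sum_mono) (rule 3)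
    also have "\<dots> = (2 + x) ^ card A * (q / x) ^ e * q" using q(1) by (simp add: T_def)
    \<comment> \<open>Lowering \<open>d\<close> by one saves the factor \<open>x / q\<close>, which
      pays for the \<open>q\<close> triples and leaves \<open>x\<close>; hence the base
      \<open>q / x\<close>.\<close>
    also have "\<dots> = (2 + x) ^ card A * (q / x) ^ d * x" using assms(3) d by simp
    finally have "real (card F) \<le> 2 * ((2 + x) ^ card A * (q / x) ^ d) + (2 + x) ^ card A * (q / x) ^ d * x"
      using 1 2 by linarith
    then show ?thesis using insert.hyps by (simp add: algebra_simps)
  qed
qed

lemma three_distinct_representatives:
  assumes "card P = 3" "card Q = 3" "card R = 3"
  obtains a b c where "a \<in> P" "b \<in> Q" "c \<in> R" "a \<noteq> b" "b \<noteq> c" "a \<noteq> c"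
proof -
  obtain a where a: "a \<in> P" using assms(1) by fastforce
  have "\<not> Q \<subseteq> {a}" using card_mono[of "{a}" Q] assms(2) by auto
  then obtain b where b: "b \<in> Q" "b \<noteq> a" by blast
  have "\<not> R \<subseteq> {a, b}" using card_mono[of "{a, b}" R] assms(3) b(2) by auto
  then obtain c where "c \<in> R" "c \<noteq> a" "c \<noteq> b" by blast
  then show ?thesis using that a b by metis
qed

text \<open>For large \<open>n\<close> the rainbow-free colourings cannot shatter
  \<open>\<theta> * n\<close> points, as three of these in progression could receive distinct
  colours. The resulting bound is \<open>(2 + x) ^ card A\<close> times a small exponential, and the
  proportion \<open>\<epsilon>\<close> missing from \<open>A\<close> outweighs both excesses over
  \<open>2 ^ card A\<close>.\<close>

lemma colorings_of_sparse_set: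
  fixes \<epsilon> :: real
  assumes "\<epsilon> > 0" "r \<ge> 3"
  shows "\<exists>N. \<forall>n\<ge>N. \<forall>A. A \<subseteq> Zn n \<longrightarrow> real (card A) \<le> (1 - \<epsilon>) * n \<longrightarrow> real (g r A n) < 2 ^ n"
proof -
  define q where "q = card {P. P \<subseteq> {1..r} \<and> card P = 3}"
  have "q = r choose 3" unfolding q_def using n_subsets[of "{1..r}" 3] by simp
  then have q1: "q \<ge> 1" using \<open>r \<ge> 3\<close> by (simp add: Suc_leI)
  \<comment> \<open>Of the saving \<open>\<epsilon> * n\<close> in the exponent, replacing 2 by
    \<open>2 + x\<close> may spend a quarter and \<open>y ^ d\<close> an eighth, plus the constant
    \<open>log 2 y\<close> for rounding \<open>d\<close> up.\<close>
  define x where "x = min 1 (2 * (2 powr (\<epsilon> / 4) - 1))"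
  have "2 powr (\<epsilon> / 4) > (1::real)" using assms(1) by simp
  then have x: "0 < x" "x \<le> 1" "x \<le> 2 * (2 powr (\<epsilon> / 4) - 1)" by (auto simp: x_def)
  then have x': "1 + x / 2 \<le> 2 powr (\<epsilon> / 4)" by (simp add: field_simps)
  define y where "y = real q / x"
  have y: "y \<ge> 1" using q1 x by (simp add: y_def)
  define \<theta> where "\<theta> = \<epsilon> / (8 * (log 2 y + 1))"
  have ly: "log 2 y \<ge> 0" using y by simp
  then have \<theta>: "\<theta> > 0" "\<theta> * log 2 y \<le> \<epsilon> / 8" using assms(1)
    by (auto simp: \<theta>_def field_simps)
  obtain N1 where N1: "\<And>n S. n \<ge> N1 \<Longrightarrow> S \<subseteq> {..<n} \<Longrightarrow> apfree S \<Longrightarrow> real (card S) < \<theta> * n"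
    using Roth[OF \<theta>(1)] by blast
  define N where "N = max N1 (nat \<lceil>2 * log 2 y / \<epsilon>\<rceil> + 1)"
  have "real (g r A n) < 2 ^ n"
    if n: "n \<ge> N" and A: "A \<subseteq> Zn n" "real (card A) \<le> (1 - \<epsilon>) * n" for n A
  proof -
    define d where "d = nat \<lceil>\<theta> * n\<rceil>"
    have d: "real d \<ge> \<theta> * n" "real d \<le> \<theta> * n + 1" 
    proof -
      have "0 \<le> \<theta> * n" using \<theta>(1) by simp
      then show "real d \<ge> \<theta> * n" "real d \<le> \<theta> * n + 1" unfolding d_def by linarith+
    qed
    have fA: "finite A" using A(1) finite_subset by (auto simp: Zn_def)
    let ?F = "rainbow_free_colorings r A n"
    have "\<not> triple_shatters ?F A {1..r} d"
    proof
      assume "triple_shatters ?F A {1..r} d"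
      then obtain S P where SP: "S \<subseteq> A" "card S = d" "\<And>s. s \<in> S \<Longrightarrow> card (P s) = 3"
        "\<And>h. (\<forall>s\<in>S. h s \<in> P s) \<Longrightarrow> (\<exists>f\<in>?F. \<forall>s\<in>S. f s = h s)"
        unfolding triple_shatters_def by blast
      \<comment> \<open>Integer progressions inside \<open>{..<n}\<close> remain progressions modulo
        \<open>n\<close>, so Roth's theorem for integers suffices.\<close>
      have "S \<subseteq> {..<n}" using SP(1) A(1) by (auto simp: Zn_def)
      then have "\<not> apfree S"
        using N1[of n S] n SP(2) d(1) by (auto simp: N_def)
      then obtain a k where ak: "k > 0" "a \<in> S" "a + k \<in> S" "a + 2 * k \<in> S"
        unfolding apfree_def by blast
      obtain u v w where uvw: "u \<in> P a" "v \<in> P (a + k)" "w \<in> P (a + 2 * k)" "u \<noteq> v" "v \<noteq> w" "u \<noteq> w"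
        using three_distinct_representatives[OF SP(3)[OF ak(2)] SP(3)[OF ak(3)] SP(3)[OF ak(4)]] by metis
      define h where "h s = (if s = a then u else if s = a + k then v else if s = a + 2 * k then w
          else (SOME c. c \<in> P s))" for s
      have "\<forall>s\<in>S. h s \<in> P s"
      proof
        fix s assume "s \<in> S"
        then have "P s \<noteq> {}" using SP(3)[of s] by auto
        then show "h s \<in> P s" using uvw by (auto simp: h_def some_in_eq)
      qed
      then obtain f where f: "f \<in> ?F" "\<forall>s\<in>S. f s = h s" using SP(4) by blast
      have "f a = u" "f (a + k) = v" "f (a + 2 * k) = w" using f(2) ak by (auto simp: h_def)
      moreover have "three_AP n a (a + k) (a + 2 * k)"
        using ak SP(1) A(1) by (auto simp: three_AP_def algebra_simps)
      moreover have "rainbow_free n A f" using f(1) by (simp add: rainbow_free_colorings_def)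
      ultimately show False
        using ak SP(1) uvw(4-6) unfolding rainbow_free_def by blast
    qed
    then have "real (g r A n) \<le> (2 + x) ^ card A * (q / x) ^ d"
      unfolding g_def using fA x q1 q_def
      by (intro card_le_if_not_triple_shatters) (auto simp: rainbow_free_colorings_def)
    also have "\<dots> = (2 + x) ^ card A * y powr d" using y by (simp add: y_def powr_realpow)
    also have "\<dots> \<le> 2 powr ((1 - \<epsilon>) * n + \<epsilon> / 4 * n) * 2 powr (\<epsilon> / 8 * n + log 2 y)"
    proof (rule mult_mono)
      have "(2 + x) ^ card A = 2 powr card A * (1 + x / 2) ^ card A"
        by (simp add: powr_realpow flip: power_mult_distrib)
      also have "\<dots> \<le> 2 powr card A * (2 powr (\<epsilon> / 4)) ^ card A"
        using x x' by (intro mult_left_mono power_mono) auto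
      also have "\<dots> = 2 powr (card A + \<epsilon> / 4 * card A)"
        by (simp add: powr_add powr_powr flip: powr_realpow)
      also have "\<dots> \<le> 2 powr ((1 - \<epsilon>) * n + \<epsilon> / 4 * n)"
      proof -
        have "card A \<le> n" using card_mono[of "Zn n" A] A(1) by (simp add: Zn_def)
        then have "\<epsilon> / 4 * card A \<le> \<epsilon> / 4 * n" using assms(1) by (intro mult_left_mono) auto
        then show ?thesis using A(2) by simp
      qed
      finally show "(2 + x) ^ card A \<le> 2 powr ((1 - \<epsilon>) * n + \<epsilon> / 4 * n)" .
      have "y powr d = 2 powr (log 2 y * d)" using y by (simp flip: powr_powr)
      also have "log 2 y * d \<le> log 2 y * (\<theta> * n + 1)" using d(2) ly by (intro mult_left_mono) auto
      also have "\<dots> = (\<theta> * log 2 y) * n + log 2 y" by (simp add: algebra_simps)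
      also have "\<dots> \<le> \<epsilon> / 8 * n + log 2 y" using mult_right_mono[OF \<theta>(2), of "real n"] by simp
      finally show "y powr d \<le> 2 powr (\<epsilon> / 8 * n + log 2 y)" by simp
    qed (use y in auto)
    also have "\<dots> = 2 powr (n - 5 / 8 * \<epsilon> * n + log 2 y)"
      by (simp add: algebra_simps flip: powr_add)
    also have "\<dots> < 2 powr n"
    proof -
      have "real n > 2 * log 2 y / \<epsilon>" using n unfolding N_def by linarith
      then have "2 * log 2 y < \<epsilon> * n" using assms(1) by (simp add: field_simps)
      moreover have "0 \<le> \<epsilon> * n" using assms(1) by simp
      ultimately have "log 2 y < 5 / 8 * \<epsilon> * n" by linarith
      then show ?thesis by simp
    qed
    also have "\<dots> = 2 ^ n" by (simp add: powr_realpow)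
    finally show ?thesis .
  qed
  then show ?thesis by blast
qed

section \<open>Counting tools\<close>

text \<open>Give \<open>S\<close> the weight \<open>x ^ card S\<close>: each small subset weighs at
  least \<open>x ^ m\<close>, and all subsets together weigh
  \<open>(1 + x) ^ card X\<close>.\<close>

lemma card_small_subsets:
  fixes x :: real
  assumes "finite X" "0 < x" "x \<le> 1"
  shows "real (card {S. S \<subseteq> X \<and> card S \<le> m}) \<le> (1 + x) ^ card X / x ^ m"
proof -
  have "real (card {S. S \<subseteq> X \<and> card S \<le> m}) * x ^ m = (\<Sum>S | S \<subseteq> X \<and> card S \<le> m. x ^ m)"
    by simp
  also have "\<dots> \<le> (\<Sum>S | S \<subseteq> X \<and> card S \<le> m. x ^ card S)"
    using assms by (intro sum_mono power_decreasing) auto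
  also have "\<dots> \<le> (\<Sum>S\<in>Pow X. x ^ card S)"
    using assms by (intro sum_mono2) auto
  also have "\<dots> = (\<Prod>i\<in>X. x + 1)"
    using prod_add[OF assms(1), of "\<lambda>_. x" "\<lambda>_. 1"] by simp
  also have "\<dots> = (1 + x) ^ card X" by (simp add: add.commute)
  finally show ?thesis using assms(2) by (simp add: field_simps)
qed

text \<open>First \<open>x\<close> is taken so small that \<open>(1 + x) ^ card X\<close> uses half
  of the exponent, then \<open>\<theta>\<close> so small that \<open>1 / x ^ m\<close> uses the
  other half.\<close>

lemma card_small_subsets_subexponential:
  fixes \<eta> R :: real
  assumes "\<eta> > 0" "R \<ge> 0"
  shows "\<exists>\<theta>>0. \<forall>n::nat. \<forall>(X::'a set) m. finite X \<longrightarrow> real (card X) \<le> R * n \<longrightarrow> real m \<le> \<theta> * n \<longrightarrow>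
    real (card {S. S \<subseteq> X \<and> card S \<le> m}) \<le> 2 powr (\<eta> * n)"
proof -
  define a where "a = \<eta> / (2 * (R + 1))"
  have a: "a > 0" "a * R \<le> \<eta> / 2" using assms by (auto simp: a_def field_simps)
  define x where "x = min 1 (2 powr a - 1)"
  have "2 powr a > (1::real)" using a by simp
  then have x: "0 < x" "x \<le> 1" "1 + x \<le> 2 powr a" by (auto simp: x_def)
  define l where "l = log 2 (1 / x)"
  have l: "l \<ge> 0" "x = 2 powr (- l)" using x by (auto simp: l_def log_divide)
  define \<theta> where "\<theta> = \<eta> / (2 * (l + 1))"
  have \<theta>: "\<theta> > 0" "l * \<theta> \<le> \<eta> / 2" using assms l by (auto simp: \<theta>_def field_simps)
  have "real (card {S. S \<subseteq> X \<and> card S \<le> m}) \<le> 2 powr (\<eta> * n)"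
    if "finite X" "real (card X) \<le> R * n" "real m \<le> \<theta> * n" for n m :: nat and X :: "'a set"
  proof -
    have "(1 + x) ^ card X \<le> (2 powr a) ^ card X" using x by (intro power_mono) auto
    also have "\<dots> = 2 powr (a * card X)" by (simp add: powr_powr flip: powr_realpow)
    finally have 1: "(1 + x) ^ card X \<le> 2 powr (a * card X)" .
    have "x ^ m = x powr m" using x(1) by (simp add: powr_realpow)
    also have "\<dots> = 2 powr (- (l * m))" by (simp only: l(2) powr_powr mult_minus_left)
    finally have 2: "1 / x ^ m = 2 powr (l * m)" by (simp add: powr_minus_divide)
    have "real (card {S. S \<subseteq> X \<and> card S \<le> m}) \<le> (1 + x) ^ card X * (1 / x ^ m)"
      using card_small_subsets[OF that(1) x(1,2)] by simp
    also have "\<dots> \<le> 2 powr (a * card X) * 2 powr (l * m)"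
      unfolding 2 using 1 by (rule mult_right_mono) simp
    also have "\<dots> = 2 powr (a * card X + l * m)" by (simp add: powr_add)
    also have "\<dots> \<le> 2 powr (\<eta> * n)"
    proof -
      have "a * card X \<le> a * (R * n)" using that(2) a by (intro mult_left_mono) auto
      also have "\<dots> \<le> \<eta> / 2 * n" using mult_right_mono[OF a(2), of "real n"] by simp
      finally have "a * card X \<le> \<eta> / 2 * n" .
      moreover have "l * m \<le> l * (\<theta> * n)" using that(3) l by (intro mult_left_mono) auto
      moreover have "l * (\<theta> * n) \<le> \<eta> / 2 * n" using mult_right_mono[OF \<theta>(2), of "real n"] by simp
      ultimately have "a * card X + l * m \<le> \<eta> * n" by linarith
      then show ?thesis by simp
    qed
    finally show ?thesis .
  qed
  then show ?thesis using \<theta>(1) by blast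
qed

text \<open>The weight \<open>1 / 2\<close> is the optimal one for a third of the points. Since
  \<open>(3 / 2) ^ 17 \<le> 2 ^ 10\<close>, the exponent is at most
  \<open>10 / 17 + 1 / 3 = 47 / 51\<close>, just below \<open>925 / 1000\<close>.\<close>

lemma card_third_subsets:
  assumes "finite X" "card X = n"
  shows "real (card {S. S \<subseteq> X \<and> 3 * card S \<le> n}) \<le> 2 powr (925 / 1000 * n)"
proof -
  have "{S. S \<subseteq> X \<and> 3 * card S \<le> n} = {S. S \<subseteq> X \<and> card S \<le> n div 3}" by auto
  then have "real (card {S. S \<subseteq> X \<and> 3 * card S \<le> n}) \<le> (3 / 2) ^ n * 2 ^ (n div 3)"
    using card_small_subsets[OF assms(1), of "1 / 2" "n div 3"] assms(2) by (simp add: power_one_over)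
  also have "\<dots> \<le> 2 powr (10 / 17 * n) * 2 powr (n / 3)"
  proof (rule mult_mono)
    have "(3 / 2 :: real) = ((3 / 2) powr 17) powr (1 / 17)" by (simp only: powr_powr) simp
    also have "\<dots> \<le> (2 powr 10) powr (1 / 17)" by (intro powr_mono2) (simp_all add: powr_numeral power_divide)
    also have "\<dots> = 2 powr (10 / 17)" by (simp only: powr_powr) simp
    finally have "(3 / 2 :: real) ^ n \<le> (2 powr (10 / 17)) ^ n" by (intro power_mono) auto
    then show "(3 / 2 :: real) ^ n \<le> 2 powr (10 / 17 * n)"
      by (simp add: powr_powr powr_realpow[symmetric])
    have "real (n div 3) \<le> n / 3" by linarith
    then have "2 powr real (n div 3) \<le> 2 powr (n / 3 :: real)" by (intro powr_mono) auto
    then show "(2::real) ^ (n div 3) \<le> 2 powr (n / 3)" by (simp add: powr_realpow)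
  qed auto
  also have "\<dots> = 2 powr (47 / 51 * n)" by (simp flip: powr_add)
  also have "\<dots> \<le> 2 powr (925 / 1000 * n)" by simp
  finally show ?thesis .
qed

text \<open>Each \<open>f\<close> in \<open>F\<close> is determined by one value on every class of
  points on which the whole family agrees. Points in classes below size \<open>D\<close> give at
  most one class each; the other classes are disjoint, so there are at most
  \<open>card C div D\<close> of them.\<close>

lemma card_le_kernel_classes:
  assumes "finite C" "finite B" "B \<noteq> {}" "F \<subseteq> C \<rightarrow>\<^sub>E B" "D > 0"
  shows "card F \<le> card B ^ (card {u \<in> C. card {y \<in> C. \<forall>f\<in>F. f y = f u} < D} + card C div D)"
proof -
  define cl where "cl u = {y \<in> C. \<forall>f\<in>F. f y = f u}" for u
  define L where "L = {u \<in> C. card (cl u) < D}"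
  define Q where "Q = cl ` C"
  have fin: "finite Q" "finite L" "\<And>u. finite (cl u)"
    using assms(1) by (auto simp: Q_def L_def cl_def)
  have B1: "card B \<ge> 1" using assms(2,3) by (simp add: Suc_leI card_gt_0_iff)
  have some: "(SOME x. x \<in> X) \<in> X" if "X \<in> Q" for X
  proof -
    have "\<exists>x. x \<in> X" using that by (auto simp: Q_def cl_def)
    then show ?thesis by (rule someI_ex)
  qed
  have "card F \<le> card (Q \<rightarrow>\<^sub>E B)"
  proof (rule card_inj_on_le[of "\<lambda>f. \<lambda>X\<in>Q. f (SOME x. x \<in> X)"])
    show "inj_on (\<lambda>f. \<lambda>X\<in>Q. f (SOME x. x \<in> X)) F"
    proof (rule inj_onI)
      fix f f' assume f: "f \<in> F" "f' \<in> F"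
        "(\<lambda>X\<in>Q. f (SOME x. x \<in> X)) = (\<lambda>X\<in>Q. f' (SOME x. x \<in> X))"
      show "f = f'"
      proof (rule PiE_ext)
        show "f \<in> C \<rightarrow>\<^sub>E B" "f' \<in> C \<rightarrow>\<^sub>E B" using f(1,2) assms(4) by auto
        fix u assume u: "u \<in> C"
        let ?v = "SOME x. x \<in> cl u"
        have "cl u \<in> Q" using u by (simp add: Q_def)
        then have "?v \<in> cl u" "f ?v = f' ?v" using some fun_cong[OF f(3), of "cl u"] by auto
        then show "f u = f' u" using f(1,2) unfolding cl_def by (metis (mono_tags, lifting) mem_Collect_eq)
      qed
    qed
    show "(\<lambda>f. \<lambda>X\<in>Q. f (SOME x. x \<in> X)) ` F \<subseteq> Q \<rightarrow>\<^sub>E B"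
    proof clarify
      fix f assume f: "f \<in> F"
      have "f (SOME x. x \<in> X) \<in> B" if X: "X \<in> Q" for X
      proof -
        have "(SOME x. x \<in> X) \<in> C" using some[OF X] X by (auto simp: Q_def cl_def)
        then show ?thesis using f assms(4) by auto
      qed
      then show "(\<lambda>X\<in>Q. f (SOME x. x \<in> X)) \<in> Q \<rightarrow>\<^sub>E B" by auto
    qed
    show "finite (Q \<rightarrow>\<^sub>E B)" using fin assms(2) by (auto intro!: finite_PiE)
  qed
  also have "\<dots> = card B ^ card Q" using fin by (simp add: card_PiE)
  also have "\<dots> \<le> card B ^ (card L + card C div D)"
  proof (rule power_increasing[OF _ B1])
    define Q' where "Q' = cl ` (C - L)"

    have "card Q' * D = (\<Sum>X\<in>Q'. D)" by simp
    also have "\<dots> \<le> (\<Sum>X\<in>Q'. card X)"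
      by (intro sum_mono) (auto simp: Q'_def L_def)
    also have "\<dots> = card (\<Union>X\<in>Q'. X)"
    proof (rule card_UN_disjoint[symmetric])
      show "\<forall>X\<in>Q'. \<forall>Y\<in>Q'. X \<noteq> Y \<longrightarrow> X \<inter> Y = {}"
      proof (intro ballI impI, rule ccontr)
        fix X Y assume XY: "X \<in> Q'" "Y \<in> Q'" "X \<noteq> Y" "X \<inter> Y \<noteq> {}"
        then obtain u v y where uv: "X = cl u" "Y = cl v" "y \<in> cl u" "y \<in> cl v"
          by (auto simp: Q'_def)
        have "\<forall>f\<in>F. f y = f u" "\<forall>f\<in>F. f y = f v" using uv(3,4) by (simp_all add: cl_def)
        then have "\<forall>f\<in>F. f u = f v" by metis
        then have "cl u = cl v" by (auto simp: cl_def)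
        then show False using XY uv by simp
      qed
    qed (use fin assms(1) in \<open>auto simp: Q'_def\<close>)
    also have "\<dots> \<le> card C" using assms(1) by (intro card_mono) (auto simp: Q'_def cl_def)
    finally have "card Q' \<le> card C div D" using assms(5) by (simp add: less_eq_div_iff_mult_less_eq)
    moreover have "Q = cl ` L \<union> Q'" by (auto simp: Q_def Q'_def L_def)
    then have "card Q \<le> card (cl ` L) + card Q'" by (simp add: card_Un_le)
    moreover have "card (cl ` L) \<le> card L" using fin by (intro card_image_le)
    ultimately show "card Q \<le> card L + card C div D" by linarith
  qed
  finally show ?thesis unfolding L_def cl_def .
qed

text \<open>The residue \<open>2 * u - x\<close>, the end of the progression that starts at
  \<open>x\<close> and has middle \<open>u\<close>. Integers avoid truncated subtraction.\<close>

definition refl_mod :: "nat \<Rightarrow> nat \<Rightarrow> nat \<Rightarrow> nat" where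
  "refl_mod n u x = nat ((2 * int u - int x) mod int n)"

lemma int_refl_mod: "n > 0 \<Longrightarrow> int (refl_mod n u x) = (2 * int u - int x) mod int n"
  by (simp add: refl_mod_def)

lemma refl_mod_in_Zn: "n > 0 \<Longrightarrow> refl_mod n u x \<in> Zn n"
  by (simp add: Zn_def refl_mod_def nat_less_iff)

lemma refl_mod_involution:
  assumes "x \<in> Zn n"
  shows "refl_mod n u (refl_mod n u x) = x"
proof -
  have n: "n > 0" "x < n" using assms by (auto simp: Zn_def)
  have "int (refl_mod n u (refl_mod n u x)) = (2 * int u - (2 * int u - int x)) mod int n"
    using n by (simp only: int_refl_mod mod_diff_right_eq)
  also have "\<dots> = int x" using n by simp
  finally show ?thesis by simp
qed

lemma three_AP_refl_mod:
  assumes "u \<in> Zn n" "x \<in> Zn n"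
  shows "three_AP n x u (refl_mod n u x)"
proof -
  have n: "n > 0" using assms by (auto simp: Zn_def)
  have "int (x + refl_mod n u x) mod int n = (int x + (2 * int u - int x)) mod int n"
    using n by (simp only: of_nat_add int_refl_mod mod_add_right_eq)
  also have "\<dots> = int (2 * u) mod int n" by simp
  finally have "[x + refl_mod n u x = 2 * u] (mod n)"
    by (simp only: cong_def of_nat_eq_iff flip: zmod_int)
  then show ?thesis using assms refl_mod_in_Zn[OF n] by (simp add: three_AP_def)
qed

text \<open>Twice the distance to the least solution is a multiple of \<open>n\<close> below
  \<open>2 * n\<close>, so a second solution can only lie \<open>n div 2\<close> further.\<close>

lemma card_doubling_fiber: "card {x \<in> Zn n. [2 * x = w] (mod n)} \<le> 2"
proof (cases "{x \<in> Zn n. [2 * x = w] (mod n)} = {}")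
  case True
  then show ?thesis by (metis card.empty zero_le)
next
  case False
  let ?X = "{x \<in> Zn n. [2 * x = w] (mod n)}"
  define x0 where "x0 = Min ?X"
  have fin: "finite ?X" by (simp add: Zn_def)
  have x0: "x0 \<in> ?X" "\<And>x. x \<in> ?X \<Longrightarrow> x0 \<le> x"
    using Min_in[OF fin False] Min_le[OF fin] by (simp_all only: x0_def)
  have "?X \<subseteq> {x0, x0 + n div 2}"
  proof
    fix x assume x: "x \<in> ?X"
    have "x0 \<le> x" using x0(2)[OF x] .
    have "[2 * x = 2 * x0] (mod n)" using x x0(1) cong_trans cong_sym by blast
    then have "n dvd 2 * x - 2 * x0" using \<open>x0 \<le> x\<close> cong_altdef_nat[of "2 * x0" "2 * x" n] cong_sym by auto
    then obtain k where k: "2 * x - 2 * x0 = n * k" by blast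
    moreover have "2 * x - 2 * x0 < n * 2" using x by (auto simp: Zn_def)
    ultimately have "k < 2" by (metis mult_less_cancel1)
    then have "k = 0 \<or> k = 1" by linarith
    then show "x \<in> {x0, x0 + n div 2}" using k \<open>x0 \<le> x\<close> by auto
  qed
  then have "card ?X \<le> card {x0, x0 + n div 2}" by (intro card_mono) auto
  also have "\<dots> \<le> 2" by (simp add: card_insert_if)
  finally show ?thesis .
qed

lemma refl_mod_eq_cong:
  assumes "refl_mod n u x = v" "x \<in> Zn n" "u \<in> Zn n"
  shows "[2 * u = x + v] (mod n)"
proof -
  have "[x + v = 2 * u] (mod n)"
    using three_AP_refl_mod[OF assms(3,2)] assms(1) by (simp only: three_AP_def)
  then show ?thesis by (rule cong_sym)
qed

lemma card_refl_mod_center_fiber: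
  assumes "x \<in> Zn n"
  shows "card {u \<in> Zn n. refl_mod n u x = v} \<le> 2"
proof -
  have "{u \<in> Zn n. refl_mod n u x = v} \<subseteq> {u \<in> Zn n. [2 * u = x + v] (mod n)}"
    using refl_mod_eq_cong[OF _ assms] by blast
  then show ?thesis
    using card_mono[of "{u \<in> Zn n. [2 * u = x + v] (mod n)}"] card_doubling_fiber[of n "x + v"]
    by (simp add: Zn_def) (meson le_trans)
qed

text \<open>A symmetric set is determined by its part in \<open>R\<close>, which meets every orbit
  of the reflection. The \<open>+ 1\<close> comes from the at most two fixed points.\<close>

lemma card_symmetric_subsets:
  assumes "u \<in> Zn n"
  shows "real (card {S. S \<subseteq> Zn n \<and> refl_mod n u ` S \<subseteq> S}) \<le> 2 powr (n / 2 + 1)"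
proof -
  have n: "n > 0" using assms by (auto simp: Zn_def)
  define R where "R = {x \<in> Zn n. x \<le> refl_mod n u x}"
  define I where "I = {x \<in> Zn n. x < refl_mod n u x}"
  define Fix where "Fix = {x \<in> Zn n. refl_mod n u x = x}"
  have fin: "finite (Zn n)" by (simp add: Zn_def)
  have "[2 * x = 2 * u] (mod n)" if "x \<in> Fix" for x
    using three_AP_refl_mod[OF assms, of x] that unfolding Fix_def three_AP_def mem_Collect_eq
    by (metis mult_2)
  then have "Fix \<subseteq> {x \<in> Zn n. [2 * x = 2 * u] (mod n)}" by (auto simp: Fix_def)
  then have F: "card Fix \<le> 2"
    using card_doubling_fiber[of n "2 * u"] card_mono[OF _ \<open>Fix \<subseteq> _\<close>] fin by simp
  have "card I + card R \<le> n"
  proof -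
    have "card I \<le> card (Zn n - R)"
    proof (rule card_inj_on_le[of "refl_mod n u"])
      show "inj_on (refl_mod n u) I"
        by (rule inj_on_inverseI[of _ "refl_mod n u"]) (simp add: I_def refl_mod_involution)
      show "refl_mod n u ` I \<subseteq> Zn n - R"
        using refl_mod_in_Zn[OF n] by (auto simp: I_def R_def refl_mod_involution)
    qed (use fin in simp)
    moreover have "R \<subseteq> Zn n" by (auto simp: R_def)
    then have "card (Zn n - R) = card (Zn n) - card R" "card R \<le> card (Zn n)"
      using fin card_mono by (auto simp: card_Diff_subset finite_subset)
    moreover have "card (Zn n) = n" by (simp add: Zn_def)
    ultimately show ?thesis by linarith
  qed
  moreover have "R = I \<union> Fix" by (auto simp: R_def I_def Fix_def)
  then have "card R \<le> card I + card Fix" by (simp add: card_Un_le)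
  ultimately have R: "2 * card R \<le> n + 2" using F by linarith
  have "card {S. S \<subseteq> Zn n \<and> refl_mod n u ` S \<subseteq> S} \<le> card (Pow R)"
  proof (rule card_inj_on_le[of "\<lambda>S. S \<inter> R"])
    have sub: "S \<subseteq> S'" if S: "S \<subseteq> Zn n" "refl_mod n u ` S \<subseteq> S" "refl_mod n u ` S' \<subseteq> S'"
      "S \<inter> R = S' \<inter> R" for S S'
    proof
      fix x assume x: "x \<in> S"
      show "x \<in> S'"
      proof (cases "x \<in> R")
        case False
        have xZ: "x \<in> Zn n" using x S(1) by blast
        have "refl_mod n u x \<in> R"
          using False xZ refl_mod_in_Zn[OF n] by (simp add: R_def refl_mod_involution)
        then have "refl_mod n u x \<in> S'" using x S by blast
        then have "refl_mod n u (refl_mod n u x) \<in> S'" using S(3) by blast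
        then show ?thesis using refl_mod_involution[OF xZ] by simp
      qed (use x S(4) in blast)
    qed
    show "inj_on (\<lambda>S. S \<inter> R) {S. S \<subseteq> Zn n \<and> refl_mod n u ` S \<subseteq> S}"
    proof (rule inj_onI)
      fix S S' assume "S \<in> {S. S \<subseteq> Zn n \<and> refl_mod n u ` S \<subseteq> S}"
        "S' \<in> {S. S \<subseteq> Zn n \<and> refl_mod n u ` S \<subseteq> S}" "S \<inter> R = S' \<inter> R"
      then show "S = S'" using sub[of S S'] sub[of S' S] by blast
    qed
  qed (use fin in \<open>auto simp: R_def\<close>)
  also have "\<dots> = 2 ^ card R" using fin by (simp add: card_Pow R_def)
  finally have "real (card {S. S \<subseteq> Zn n \<and> refl_mod n u ` S \<subseteq> S}) \<le> 2 ^ card R"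
    by (metis of_nat_le_iff of_nat_numeral of_nat_power)
  also have "\<dots> = 2 powr card R" by (simp add: powr_realpow)
  also have "\<dots> \<le> 2 powr (n / 2 + 1)" using R by (intro powr_mono) auto
  finally show ?thesis .
qed

text \<open>\<open>G\<close> is the union of its largest symmetric part and the few points whose
  mirror image leaves \<open>G\<close>.\<close>

lemma card_nearly_symmetric_subsets:
  assumes "u \<in> Zn n"
  shows "real (card {G. G \<subseteq> Zn n \<and> card {x \<in> G. refl_mod n u x \<notin> G} \<le> m}) \<le>
    2 powr (n / 2 + 1) * real (card {E. E \<subseteq> Zn n \<and> card E \<le> m})"
proof -
  let ?Y = "{S. S \<subseteq> Zn n \<and> refl_mod n u ` S \<subseteq> S}" and ?E = "{E. E \<subseteq> Zn n \<and> card E \<le> m}"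
  have fin: "finite (Zn n)" by (simp add: Zn_def)
  have "{G. G \<subseteq> Zn n \<and> card {x \<in> G. refl_mod n u x \<notin> G} \<le> m} \<subseteq> (\<lambda>(S, E). S \<union> E) ` (?Y \<times> ?E)"
  proof clarify
    fix G assume G: "G \<subseteq> Zn n" "card {x \<in> G. refl_mod n u x \<notin> G} \<le> m"
    let ?S = "{x \<in> G. refl_mod n u x \<in> G}"
    have "?S \<in> ?Y" using G(1) refl_mod_involution by fastforce
    moreover have "{x \<in> G. refl_mod n u x \<notin> G} \<in> ?E" using G by auto
    moreover have "G = ?S \<union> {x \<in> G. refl_mod n u x \<notin> G}" by auto
    ultimately show "G \<in> (\<lambda>(S, E). S \<union> E) ` (?Y \<times> ?E)" by (intro image_eqI[of _ _ "(?S, _)"]) auto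
  qed
  then have "card {G. G \<subseteq> Zn n \<and> card {x \<in> G. refl_mod n u x \<notin> G} \<le> m} \<le> card (?Y \<times> ?E)"
    using fin by (intro surj_card_le) auto
  then have "real (card {G. G \<subseteq> Zn n \<and> card {x \<in> G. refl_mod n u x \<notin> G} \<le> m}) \<le>
      real (card ?Y) * real (card ?E)"
    by (simp add: card_cartesian_product flip: of_nat_mult)
  also have "\<dots> \<le> 2 powr (n / 2 + 1) * real (card ?E)"
    using card_symmetric_subsets[OF assms] by (rule mult_right_mono) simp
  finally show ?thesis .
qed

section \<open>Colourings of almost all residues\<close>

lemma finite_Zn: "finite (Zn n)" and card_Zn: "card (Zn n) = n"
  by (simp_all add: Zn_def)

lemma rainbow_freeD:
  assumes "rainbow_free n A f" "three_AP n a b c" "a \<in> A" "b \<in> A" "c \<in> A"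
    "f a \<noteq> f b" "f b \<noteq> f c" "f a \<noteq> f c"
  shows False
  using assms unfolding rainbow_free_def by blast

text \<open>A progression through a point of \<open>G\<close> forces its two other points, if they lie outside \<open>G\<close>, to
  have the same colour. The set \<open>cl u\<close> consists of the points that always agree with \<open>u\<close>, and \<open>L\<close> of
  the points with little forced agreement.\<close>

locale prescribed_class =
  fixes n :: nat and A :: "nat set" and T :: "nat set" and \<gamma> :: nat and G :: "nat set" and D :: nat
  assumes A: "A \<subseteq> Zn n" and T: "finite T" "2 \<le> card T" "\<gamma> \<in> T" and G: "G \<subseteq> A" and D: "D > 0"
begin

definition F :: "(nat \<Rightarrow> nat) set" where
  "F = {f \<in> A \<rightarrow>\<^sub>E T. rainbow_free n A f \<and> {x \<in> A. f x = \<gamma>} = G}"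

definition cl :: "nat \<Rightarrow> nat set" where
  "cl u = {y \<in> A - G. \<forall>f\<in>F. f y = f u}"

definition L :: "nat set" where
  "L = {u \<in> A - G. card (cl u) < D}"

text \<open>A progression through a point \<open>u\<close> of \<open>L\<close> and a point of
  \<open>G\<close> that does not end in \<open>G\<close> must end outside \<open>A\<close> or in
  \<open>cl u\<close>; \<open>m\<close> bounds the number of these places.\<close>

definition m :: nat where
  "m = card (Zn n - A) + D"

lemma fin: "finite A" "finite G" "finite L" "finite (Zn n - A)" "finite (cl u)"
proof -
  show "finite A" using A finite_Zn by (rule finite_subset)
  then show "finite G" "finite L" "finite (cl u)" using G by (auto simp: L_def cl_def finite_subset)
  show "finite (Zn n - A)" using finite_Zn by simp
qed

lemma F_value: "f \<in> F \<Longrightarrow> x \<in> A \<Longrightarrow> f x = \<gamma> \<longleftrightarrow> x \<in> G"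
  unfolding F_def by blast

lemma third_point_in_cl:
  assumes "u \<in> A - G" "w \<in> G" "y \<in> A - G" "three_AP n w u y \<or> three_AP n u w y"
  shows "y \<in> cl u"
proof -
  have "f y = f u" if f: "f \<in> F" for f
  proof (rule ccontr)
    assume ne: "f y \<noteq> f u"
    have rf: "rainbow_free n A f" using f by (simp add: F_def)
    have 1: "f w = \<gamma>" "f u \<noteq> \<gamma>" "f y \<noteq> \<gamma>" using F_value[OF f] assms(1-3) G by auto
    from assms(4) show False
    proof
      assume "three_AP n w u y"
      from rainbow_freeD[OF rf this] show False using 1 ne assms(1-3) G by auto
    next
      assume "three_AP n u w y"
      from rainbow_freeD[OF rf this] show False using 1 ne assms(1-3) G by auto
    qed
  qed
  then show ?thesis using assms(3) by (simp add: cl_def)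
qed

lemma card_escape:
  assumes "u \<in> L"
  shows "card ((Zn n - A) \<union> cl u) \<le> m"
proof -
  have "card (cl u) < D" using assms by (simp add: L_def)
  then show ?thesis using card_Un_le[of "Zn n - A" "cl u"] unfolding m_def by linarith
qed

lemma nearly_symmetric:
  assumes "u \<in> L"
  shows "card {w \<in> G. refl_mod n u w \<notin> G} \<le> m"
proof -
  have u: "u \<in> A - G" "u \<in> Zn n" "n > 0" using assms A by (auto simp: L_def Zn_def)
  have "card {w \<in> G. refl_mod n u w \<notin> G} \<le> card ((Zn n - A) \<union> cl u)"
  proof (rule card_inj_on_le[of "refl_mod n u"])
    show "inj_on (refl_mod n u) {w \<in> G. refl_mod n u w \<notin> G}"
      by (rule inj_on_inverseI[of _ "refl_mod n u"]) (use G A refl_mod_involution in auto)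
    show "refl_mod n u ` {w \<in> G. refl_mod n u w \<notin> G} \<subseteq> (Zn n - A) \<union> cl u"
    proof (rule image_subsetI)
      fix w assume w: "w \<in> {w \<in> G. refl_mod n u w \<notin> G}"
      then have "three_AP n w u (refl_mod n u w)" using three_AP_refl_mod u(2) G A by blast
      then have "refl_mod n u w \<in> A \<Longrightarrow> refl_mod n u w \<in> cl u"
        using third_point_in_cl[OF u(1), of w] w by blast
      then show "refl_mod n u w \<in> (Zn n - A) \<union> cl u" using refl_mod_in_Zn[OF u(3)] by blast
    qed
  qed (use fin in simp)
  then show ?thesis using card_escape[OF assms] by linarith
qed

text \<open>Here the point of \<open>G\<close> is the middle term. One end may belong to two centres
  when \<open>n\<close> is even, hence the factor two.\<close>

lemma few_escaping_centers:
  assumes "u \<in> L"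
  shows "card {w \<in> G. refl_mod n w u \<notin> G} \<le> 2 * m"
proof -
  let ?X = "{w \<in> G. refl_mod n w u \<notin> G}" and ?Y = "(Zn n - A) \<union> cl u"
  have u: "u \<in> A - G" "u \<in> Zn n" "n > 0" using assms A by (auto simp: L_def Zn_def)
  have "?X \<subseteq> (\<Union>v\<in>?Y. {w \<in> Zn n. refl_mod n w u = v})"
  proof
    fix w assume w: "w \<in> ?X"
    have gZ: "w \<in> Zn n" using w G A by blast
    have "three_AP n u w (refl_mod n w u)" using three_AP_refl_mod[OF gZ u(2)] .
    then have "refl_mod n w u \<in> A \<Longrightarrow> refl_mod n w u \<in> cl u"
      using third_point_in_cl[OF u(1), of w] w by blast
    then show "w \<in> (\<Union>v\<in>?Y. {w \<in> Zn n. refl_mod n w u = v})"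
      using gZ refl_mod_in_Zn[OF u(3)] by blast
  qed
  then have "card ?X \<le> card (\<Union>v\<in>?Y. {w \<in> Zn n. refl_mod n w u = v})"
    using fin finite_Zn by (intro card_mono) auto
  also have "\<dots> \<le> (\<Sum>v\<in>?Y. card {w \<in> Zn n. refl_mod n w u = v})"
    using fin by (intro card_UN_le) auto
  also have "\<dots> \<le> (\<Sum>v\<in>?Y. 2)" by (intro sum_mono card_refl_mod_center_fiber u(2))
  also have "\<dots> \<le> 2 * m" using card_escape[OF assms] by simp
  finally show ?thesis .
qed

text \<open>Double counting of the pairs \<open>(u, w)\<close> with \<open>2 w - u \<in> G\<close>: such a pair is determined by
  \<open>w\<close> and \<open>2 w - u\<close>.\<close>

lemma card_L:
  "real (card L) * (real (card G) - 2 * real m) \<le> (real (card G))\<^sup>2"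
proof -
  define P where "P = Sigma L (\<lambda>u. {w \<in> G. refl_mod n w u \<in> G})"
  have "real (card L) * (real (card G) - 2 * real m) = (\<Sum>u\<in>L. real (card G) - 2 * real m)"
    by simp
  also have "\<dots> \<le> (\<Sum>u\<in>L. real (card {w \<in> G. refl_mod n w u \<in> G}))"
  proof (rule sum_mono)
    fix u assume u: "u \<in> L"
    have "G = {w \<in> G. refl_mod n w u \<in> G} \<union> {w \<in> G. refl_mod n w u \<notin> G}" by auto
    then have "card G \<le> card {w \<in> G. refl_mod n w u \<in> G} + card {w \<in> G. refl_mod n w u \<notin> G}"
      by (metis (no_types, lifting) card_Un_le)
    then show "real (card G) - 2 * real m \<le> real (card {w \<in> G. refl_mod n w u \<in> G})"
      using few_escaping_centers[OF u] by linarith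
  qed
  also have "\<dots> = real (card P)"
    unfolding P_def using fin by (subst card_SigmaI) auto
  also have "card P \<le> card (G \<times> G)"
  proof (rule card_inj_on_le[of "\<lambda>(u, w). (w, refl_mod n w u)"])
    show "inj_on (\<lambda>(u, w). (w, refl_mod n w u)) P"
    proof (rule inj_on_inverseI[of _ "\<lambda>(w, v). (refl_mod n w v, w)"])
      fix p assume "p \<in> P"
      moreover obtain u w where "p = (u, w)" by (cases p)
      ultimately have "u \<in> Zn n" "p = (u, w)" using A by (auto simp: P_def L_def)
      then show "(\<lambda>(w, v). (refl_mod n w v, w)) ((\<lambda>(u, w). (w, refl_mod n w u)) p) = p"
        by (simp add: refl_mod_involution)
    qed
  qed (use fin in \<open>auto simp: P_def\<close>)
  finally show ?thesis by (simp add: card_cartesian_product power2_eq_square)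
qed

text \<open>All members of \<open>F\<close> are constantly \<open>\<gamma>\<close> on
  \<open>G\<close>, so restricting to \<open>A - G\<close> loses nothing and leaves one colour
  fewer. There the kernel classes are the sets \<open>cl u\<close>.\<close>

lemma card_F: "card F \<le> (card T - 1) ^ (card L + n div D)"
proof -
  let ?R = "\<lambda>f. restrict f (A - G)"
  have "inj_on ?R F"
  proof (rule inj_onI)
    fix f f' assume f: "f \<in> F" "f' \<in> F" "?R f = ?R f'"
    show "f = f'"
    proof (rule PiE_ext)
      show "f \<in> A \<rightarrow>\<^sub>E T" "f' \<in> A \<rightarrow>\<^sub>E T" using f by (auto simp: F_def)
      fix x assume x: "x \<in> A"
      show "f x = f' x"
      proof (cases "x \<in> G")
        case True
        then show ?thesis using F_value[OF f(1) x] F_value[OF f(2) x] by simp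
      next
        case False
        then show ?thesis using fun_cong[OF f(3), of x] x by simp
      qed
    qed
  qed
  then have "card F = card (?R ` F)" by (simp add: card_image)
  also have "\<dots> \<le> card (T - {\<gamma>}) ^
      (card {u \<in> A - G. card {y \<in> A - G. \<forall>f\<in>?R ` F. f y = f u} < D} + card (A - G) div D)"
  proof (rule card_le_kernel_classes)
    show "T - {\<gamma>} \<noteq> {}" using T card_mono[of "{\<gamma>}" T] by auto
    have "\<forall>x\<in>A - G. f x \<in> T - {\<gamma>}" if "f \<in> F" for f
      using F_value[OF that] that by (auto simp: F_def)
    then show "?R ` F \<subseteq> A - G \<rightarrow>\<^sub>E (T - {\<gamma>})"
      by (intro image_subsetI) (simp add: restrict_PiE_iff)
  qed (use fin T D in auto)
  also have "{u \<in> A - G. card {y \<in> A - G. \<forall>f\<in>?R ` F. f y = f u} < D} = L"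
    unfolding L_def cl_def
  proof (rule Collect_cong, rule conj_cong[OF refl])
    fix u assume "u \<in> A - G"
    then have "{y \<in> A - G. \<forall>f\<in>?R ` F. f y = f u} = {y \<in> A - G. \<forall>f\<in>F. f y = f u}" by auto
    then show "(card {y \<in> A - G. \<forall>f\<in>?R ` F. f y = f u} < D) =
        (card {y \<in> A - G. \<forall>f\<in>F. f y = f u} < D)" by simp
  qed
  also have "card (T - {\<gamma>}) = card T - 1" using T by simp
  also have "(card T - 1) ^ (card L + card (A - G) div D) \<le> (card T - 1) ^ (card L + n div D)"
  proof (rule power_increasing)
    have "card (A - G) \<le> card (Zn n)" using A finite_Zn by (intro card_mono) auto
    then show "card L + card (A - G) div D \<le> card L + n div D"
      by (simp add: div_le_mono card_Zn)
  qed (use T in linarith)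
  finally show ?thesis .
qed

end

text \<open>Equality holds at \<open>t = 5\<close>, which fixes the exponent \<open>2 / 5\<close>
  below. From \<open>t = 6\<close> on, raising \<open>t\<close> by one multiplies the left side by
  at most \<open>(6 / 5) ^ 5 < 4\<close>.\<close>

lemma power5_le_power4:
  fixes t :: nat
  assumes "t \<ge> 3"
  shows "(t - 1) ^ 5 \<le> 4 ^ t"
proof -
  have "(k + 5) ^ 5 \<le> 4 ^ (k + 6)" for k :: nat
  proof (induction k)
    case (Suc k)
    have "(Suc k + 5) ^ 5 \<le> 4 * (k + 5) ^ 5"
    proof -
      have "5 * (k + 6) \<le> 6 * (k + 5)" by simp
      then have "(5 * (k + 6)) ^ 5 \<le> (6 * (k + 5)) ^ 5" by (rule power_mono) simp
      then have "3125 * (k + 6) ^ 5 \<le> 7776 * (k + 5) ^ 5" by (simp only: power_mult_distrib) simp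
      moreover have "a \<le> 4 * b" if "3125 * a \<le> 7776 * b" for a b :: nat using that by linarith
      ultimately have "(k + 6) ^ 5 \<le> 4 * (k + 5) ^ 5" by blast
      moreover have "Suc k + 5 = k + 6" by simp
      ultimately show ?thesis by (simp only:)
    qed
    also have "\<dots> \<le> 4 * 4 ^ (k + 6)" by (rule mult_le_mono2[OF Suc])
    also have "\<dots> = 4 ^ (Suc k + 6)" by (simp only: add_Suc power_Suc)
    finally show ?case .
  qed simp
  from this[of "t - 6"] have *: "(t - 1) ^ 5 \<le> 4 ^ t" if "t \<ge> 6" using that by simp
  have "t = 3 \<or> t = 4 \<or> t = 5 \<or> t \<ge> 6" using assms by linarith
  then show ?thesis using * by auto
qed

lemma pred_le_powr:
  assumes "t \<ge> 3"
  shows "real (t - 1) \<le> 2 powr (2 / 5 * t)"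
proof -
  have "real ((t - 1) ^ 5) \<le> real (4 ^ t)" using power5_le_power4[OF assms] by (rule of_nat_mono)
  then have "real (t - 1) powr 5 \<le> 2 powr (2 * t)"
    using assms by (simp add: powr_numeral powr_powr[symmetric] powr_realpow)
  then have "(real (t - 1) powr 5) powr (1 / 5) \<le> (2 powr (2 * t)) powr (1 / 5)"
    by (intro powr_mono2) auto
  moreover have "(real (t - 1) powr 5) powr (1 / 5) = real (t - 1)"
    using assms by (simp only: powr_powr) simp
  moreover have "(2 powr real (2 * t)) powr (1 / 5) = 2 powr (2 / 5 * real t)"
    by (simp only: powr_powr) simp
  ultimately show ?thesis by linarith
qed

section \<open>Colourings in which every colour class is large\<close>

lemma card_sum_classes:
  assumes "finite A" "finite T" "f ` A \<subseteq> T"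
  shows "(\<Sum>c\<in>T. card {x \<in> A. f x = c}) = card A"
  using sum.group[OF assms, of "\<lambda>_. 1 :: nat"] by simp

text \<open>Since \<open>D\<close> is at least \<open>40 * card T\<close>, the
  \<open>n div D\<close> large kernel classes add at most \<open>2 / 5 * n / 40 = n / 100\<close> to
  the exponent.\<close>

lemma (in prescribed_class) card_F_powr:
  assumes "3 \<le> card T" "40 * card T \<le> D"
  shows "real (card F) \<le> 2 powr (2 / 5 * card T * card L + n / 100)"
proof -
  let ?t = "real (card T)" and ?e = "card L + n div D"
  have "real (card F) \<le> real (card T - 1) ^ ?e"
    using card_F by (simp flip: of_nat_power)
  also have "\<dots> \<le> (2 powr (2 / 5 * ?t)) ^ ?e"
    using pred_le_powr[OF assms(1)] by (intro power_mono) auto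
  also have "\<dots> = 2 powr (2 / 5 * ?t * ?e)" by (simp add: powr_powr powr_realpow[symmetric])
  also have "\<dots> \<le> 2 powr (2 / 5 * ?t * card L + n / 100)"
  proof -
    have "real (n div D) \<le> n / D" by (rule of_nat_div_le_of_nat)
    then have "?t * real (n div D) \<le> ?t * (n / D)" by (rule mult_left_mono) simp
    also have "\<dots> \<le> (D / 40) * (n / D)" using assms(2) by (intro mult_right_mono) auto
    also have "\<dots> = n / 40" using D by simp
    finally show ?thesis by (simp add: algebra_simps)
  qed
  finally show ?thesis .
qed

text \<open>The smallest class \<open>G\<close> has at most \<open>n / card T\<close> points. If
  \<open>L\<close> is empty, there are at most \<open>2^(0.925 n)\<close> such \<open>G\<close> with
  \<open>2^(0.01 n)\<close> colourings each. Otherwise \<open>G\<close> is nearly symmetric about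
  one of \<open>n\<close> centres, which leaves \<open>2^(0.51 n + 1)\<close> sets per centre with
  \<open>2^(0.45 n)\<close> colourings each.\<close>

lemma card_all_big_classes:
  fixes \<kappa> :: real
  assumes A: "A \<subseteq> Zn n" and T: "finite T" "3 \<le> card T" "card T \<le> r"
    and D: "40 * r \<le> D" and \<kappa>: "22 * real (card (Zn n - A) + D) \<le> \<kappa> * n"
    and small: "real (card {E. E \<subseteq> Zn n \<and> card E \<le> card (Zn n - A) + D}) \<le> 2 powr (n / 100)"
  shows "real (card {f \<in> A \<rightarrow>\<^sub>E T. rainbow_free n A f \<and> (\<forall>c\<in>T. \<kappa> * n \<le> real (card {x \<in> A. f x = c}))})
    \<le> r * (2 powr (935 / 1000 * n) + n * 2 powr (96 / 100 * n + 1))"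
    (is "real (card ?F) \<le> _")
proof -
  let ?t = "card T"
  have D0: "D > 0" "40 * ?t \<le> D" using D T by auto
  define H where "H = {G. G \<subseteq> A \<and> \<kappa> * n \<le> real (card G) \<and> ?t * card G \<le> n}"
  define Fc where "Fc \<gamma> G = prescribed_class.F n A T \<gamma> G" for \<gamma> G
  define Lc where "Lc \<gamma> G = prescribed_class.L n A T \<gamma> G D" for \<gamma> G
  have fA: "finite A" using A finite_Zn by (rule finite_subset)
  have fH: "finite H" unfolding H_def by (rule finite_subset[of _ "Pow A"]) (use fA in auto)
  have pc: "prescribed_class n A T \<gamma> G D" if "\<gamma> \<in> T" "G \<in> H" for \<gamma> G
    using that A T D0 by unfold_locales (auto simp: H_def)
  have finF: "finite (Fc \<gamma> G)" if "\<gamma> \<in> T" "G \<in> H" for \<gamma> G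
    unfolding Fc_def prescribed_class.F_def[OF pc[OF that]]
    by (rule finite_subset[of _ "A \<rightarrow>\<^sub>E T"]) (use fA T in \<open>auto intro!: finite_PiE\<close>)
  have mn: "card (Zn n - A) + D > 0" using D0 by simp
  have bound: "real (card (Fc \<gamma> G)) \<le> 2 powr (2 / 5 * ?t * card (Lc \<gamma> G) + n / 100)"
    if "\<gamma> \<in> T" "G \<in> H" for \<gamma> G
    using prescribed_class.card_F_powr[OF pc[OF that] T(2) D0(2)] by (simp add: Fc_def Lc_def)
  have bound': "real (card (Fc \<gamma> G)) \<le> 2 powr (45 / 100 * n)" if "\<gamma> \<in> T" "G \<in> H" for \<gamma> G
  proof -
    interpret prescribed_class n A T \<gamma> G D by (rule pc[OF that])
    have G1: "22 * real m \<le> real (card G)" "?t * card G \<le> n"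
      using that(2) \<kappa> by (auto simp: H_def m_def)
    have "m > 0" using mn by (simp add: m_def)
    then have "real m > 0" by simp
    then have G0: "real (card G) > 0" using G1 by linarith
    \<comment> \<open>As \<open>22 * m \<le> card G\<close>, the term \<open>2 * m\<close> costs at
      most \<open>card G / 11\<close>. Thus \<open>card L \<le> 11 / 10 * card G\<close>, and
      \<open>2 / 5 * 11 / 10 + 1 / 100 = 45 / 100\<close>.\<close>
    have "real (card L) * (10 / 11 * card G) \<le> real (card L) * (real (card G) - 2 * real m)"
      using G1 by (intro mult_left_mono) auto
    also have "\<dots> \<le> (real (card G))\<^sup>2" by (rule card_L)
    finally have "real (card L) * (10 / 11) \<le> real (card G)"
      using G0 by (simp add: power2_eq_square)
    then have "real ?t * real (card L) \<le> real ?t * (11 / 10 * real (card G))"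
      by (intro mult_left_mono) auto
    also have "\<dots> \<le> 11 / 10 * n" using G1(2) by (simp flip: of_nat_mult)
    finally have "2 / 5 * real ?t * real (card L) + n / 100 \<le> 45 / 100 * n" by simp
    then have "2 powr (2 / 5 * ?t * card L + n / 100) \<le> 2 powr (45 / 100 * n)" by simp
    then show ?thesis using bound[OF that] unfolding Lc_def by linarith
  qed
  define H1 where "H1 \<gamma> = {G \<in> H. Lc \<gamma> G = {}}" for \<gamma>
  define H2 where "H2 \<gamma> = {G \<in> H. Lc \<gamma> G \<noteq> {}}" for \<gamma>
  have H1: "real (card (H1 \<gamma>)) \<le> 2 powr (925 / 1000 * n)" for \<gamma>
  proof -
    have "3 * card G \<le> n" if "G \<in> H" for G
    proof -
      have "3 * card G \<le> ?t * card G" using T(2) by (rule mult_le_mono1)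
      moreover have "?t * card G \<le> n" using that by (simp add: H_def)
      ultimately show ?thesis by linarith
    qed
    then have "H1 \<gamma> \<subseteq> {G. G \<subseteq> Zn n \<and> 3 * card G \<le> n}" using A by (auto simp: H1_def H_def)
    then have "card (H1 \<gamma>) \<le> card {G. G \<subseteq> Zn n \<and> 3 * card G \<le> n}"
      by (intro card_mono) (simp_all add: finite_Zn)
    then show ?thesis using card_third_subsets[OF finite_Zn card_Zn, of n] by linarith
  qed
  have H2: "real (card (H2 \<gamma>)) \<le> n * (2 powr (n / 2 + 1) * 2 powr (n / 100))" if \<gamma>: "\<gamma> \<in> T" for \<gamma>
  proof -
    let ?S = "\<lambda>u. {G. G \<subseteq> Zn n \<and> card {w \<in> G. refl_mod n u w \<notin> G} \<le> card (Zn n - A) + D}"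
    have "H2 \<gamma> \<subseteq> (\<Union>u\<in>Zn n. ?S u)"
    proof
      fix G assume GH: "G \<in> H2 \<gamma>"
      then interpret prescribed_class n A T \<gamma> G D using pc \<gamma> by (simp add: H2_def)
      obtain u where "u \<in> L" using GH by (auto simp: H2_def Lc_def)
      then have "u \<in> Zn n" "card {w \<in> G. refl_mod n u w \<notin> G} \<le> m"
        using A nearly_symmetric by (auto simp: L_def)
      moreover have "G \<subseteq> Zn n" using G A by blast
      ultimately show "G \<in> (\<Union>u\<in>Zn n. ?S u)" by (auto simp: m_def)
    qed
    then have "card (H2 \<gamma>) \<le> card (\<Union>u\<in>Zn n. ?S u)"
      using finite_Zn by (intro card_mono) auto
    also have "\<dots> \<le> (\<Sum>u\<in>Zn n. card (?S u))" by (rule card_UN_le[OF finite_Zn])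
    finally have "real (card (H2 \<gamma>)) \<le> (\<Sum>u\<in>Zn n. real (card (?S u)))"
      by (simp flip: of_nat_sum)
    also have "\<dots> \<le> (\<Sum>u\<in>Zn n. 2 powr (n / 2 + 1) * 2 powr (n / 100))"
    proof (rule sum_mono)
      fix u assume "u \<in> Zn n"
      then show "real (card (?S u)) \<le> 2 powr (n / 2 + 1) * 2 powr (n / 100)"
        by (intro order_trans[OF card_nearly_symmetric_subsets mult_left_mono[OF small]]) auto
    qed
    also have "\<dots> = n * (2 powr (n / 2 + 1) * 2 powr (n / 100))" by (simp add: card_Zn)
    finally show ?thesis .
  qed
  have "?F \<subseteq> (\<Union>\<gamma>\<in>T. \<Union>G\<in>H. Fc \<gamma> G)"
  proof
    fix f assume f: "f \<in> ?F"
    \<comment> \<open>By averaging, the smallest class has at most \<open>n / card T\<close>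
      points.\<close>
    have "\<exists>c\<in>T. ?t * card {x \<in> A. f x = c} \<le> n"
    proof (rule ccontr)
      assume "\<not> ?thesis"
      then have "(\<Sum>c\<in>T. n) < (\<Sum>c\<in>T. ?t * card {x \<in> A. f x = c})"
        using T by (intro sum_strict_mono) auto
      also have "\<dots> = ?t * card A"
        using card_sum_classes[of A T f] fA T(1) f by (auto simp flip: sum_distrib_left)
      also have "\<dots> \<le> ?t * n"
        using card_mono[OF finite_Zn A] by (simp add: card_Zn)
      finally show False by simp
    qed
    then obtain c where c: "c \<in> T" "?t * card {x \<in> A. f x = c} \<le> n" by blast
    define G where "G = {x \<in> A. f x = c}"
    have G: "G \<in> H" using f c by (auto simp: H_def G_def)
    have "f \<in> Fc c G"
      unfolding Fc_def prescribed_class.F_def[OF pc[OF c(1) G]] using f by (simp add: G_def)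
    then show "f \<in> (\<Union>\<gamma>\<in>T. \<Union>G\<in>H. Fc \<gamma> G)" using c(1) G by blast
  qed
  then have "card ?F \<le> card (\<Union>\<gamma>\<in>T. \<Union>G\<in>H. Fc \<gamma> G)"
    using T(1) fH finF by (intro card_mono) auto
  also have "\<dots> \<le> (\<Sum>\<gamma>\<in>T. card (\<Union>G\<in>H. Fc \<gamma> G))" by (rule card_UN_le[OF T(1)])
  also have "\<dots> \<le> (\<Sum>\<gamma>\<in>T. \<Sum>G\<in>H. card (Fc \<gamma> G))" by (intro sum_mono card_UN_le fH)
  finally have "real (card ?F) \<le> (\<Sum>\<gamma>\<in>T. \<Sum>G\<in>H. real (card (Fc \<gamma> G)))"
    by (simp flip: of_nat_sum)
  also have "\<dots> \<le> (\<Sum>\<gamma>\<in>T. 2 powr (935 / 1000 * n) + n * 2 powr (96 / 100 * n + 1))"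
  proof (rule sum_mono)
    fix \<gamma> assume \<gamma>: "\<gamma> \<in> T"
    have "(\<Sum>G\<in>H. real (card (Fc \<gamma> G))) =
        (\<Sum>G\<in>H1 \<gamma>. real (card (Fc \<gamma> G))) + (\<Sum>G\<in>H2 \<gamma>. real (card (Fc \<gamma> G)))"
      using fH by (subst sum.union_disjoint[symmetric]) (auto simp: H1_def H2_def intro!: sum.cong)
    also have "(\<Sum>G\<in>H1 \<gamma>. real (card (Fc \<gamma> G))) \<le> (\<Sum>G\<in>H1 \<gamma>. 2 powr (n / 100))"
    proof (rule sum_mono)
      fix G assume "G \<in> H1 \<gamma>"
      then have "G \<in> H" "Lc \<gamma> G = {}" by (auto simp: H1_def)
      then show "real (card (Fc \<gamma> G)) \<le> 2 powr (n / 100)" using bound[OF \<gamma>, of G] by simp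
    qed
    also have "\<dots> = card (H1 \<gamma>) * 2 powr (n / 100)" by simp
    also have "\<dots> \<le> 2 powr (925 / 1000 * n) * 2 powr (n / 100)" by (rule mult_right_mono[OF H1]) simp
    also have "\<dots> = 2 powr (935 / 1000 * n)" by (simp flip: powr_add)
    also have "(\<Sum>G\<in>H2 \<gamma>. real (card (Fc \<gamma> G))) \<le> (\<Sum>G\<in>H2 \<gamma>. 2 powr (45 / 100 * n))"
    proof (rule sum_mono)
      fix G assume "G \<in> H2 \<gamma>"
      then have "G \<in> H" by (simp add: H2_def)
      then show "real (card (Fc \<gamma> G)) \<le> 2 powr (45 / 100 * n)" by (rule bound'[OF \<gamma>])
    qed
    also have "\<dots> = card (H2 \<gamma>) * 2 powr (45 / 100 * n)" by simp
    also have "\<dots> \<le> n * (2 powr (n / 2 + 1) * 2 powr (n / 100)) * 2 powr (45 / 100 * n)"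
      by (rule mult_right_mono[OF H2[OF \<gamma>]]) simp
    also have "\<dots> = n * (2 powr (n / 2 + 1) * 2 powr (n / 100) * 2 powr (45 / 100 * n))" by simp
    also have "2 powr (n / 2 + 1) * 2 powr (n / 100) * 2 powr (45 / 100 * n) = 2 powr (96 / 100 * n + 1)"
      by (simp add: algebra_simps flip: powr_add)
    finally show "(\<Sum>G\<in>H. real (card (Fc \<gamma> G))) \<le>
        2 powr (935 / 1000 * n) + n * 2 powr (96 / 100 * n + 1)" by simp
  qed
  also have "\<dots> = ?t * (2 powr (935 / 1000 * n) + n * 2 powr (96 / 100 * n + 1))" by simp
  also have "\<dots> \<le> r * (2 powr (935 / 1000 * n) + n * 2 powr (96 / 100 * n + 1))"
    using T(3) by (intro mult_right_mono) auto
  finally show ?thesis .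
qed

text \<open>Overwrites \<open>h\<close> by the partial colouring with graph \<open>W\<close>, so
  that exceptions are counted as small subsets of a product. A \<open>W\<close> that is not a graph
  may give unspecified values, harmless for an upper bound.\<close>

definition patch :: "nat set \<Rightarrow> (nat \<times> nat) set \<Rightarrow> (nat \<Rightarrow> nat) \<Rightarrow> nat \<Rightarrow> nat" where
  "patch A W h = (\<lambda>x\<in>A. if x \<in> fst ` W then THE c. (x, c) \<in> W else h x)"

lemma patch_graph:
  assumes "f \<in> extensional A" "\<And>x. x \<in> A - Q \<Longrightarrow> h x = f x"
  shows "patch A ((\<lambda>x. (x, f x)) ` Q) h = f"
proof
  fix x
  let ?W = "(\<lambda>x. (x, f x)) ` Q"
  show "patch A ?W h x = f x"
  proof (cases "x \<in> A")
    case False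
    then show ?thesis using extensional_arb[OF assms(1) False] by (simp add: patch_def)
  next
    case True
    have "fst ` ?W = Q" by (simp add: image_image)
    moreover have "(THE c. (x, c) \<in> ?W) = f x" if "x \<in> Q"
      by (rule the_equality) (use that in auto)
    ultimately show ?thesis using True assms(2)[of x] by (simp add: patch_def)
  qed
qed

text \<open>Recolouring the small classes with one of the large colours cannot create rainbow
  progressions, so colourings with at least three large classes reduce to the case where every
  colour is large.\<close>

lemma card_three_big_classes:
  fixes \<kappa> :: real
  assumes A: "A \<subseteq> Zn n"
    and D: "40 * r \<le> D" and \<kappa>: "22 * real (card (Zn n - A) + D) \<le> \<kappa> * n"
    and small: "real (card {E. E \<subseteq> Zn n \<and> card E \<le> card (Zn n - A) + D}) \<le> 2 powr (n / 100)"
    and k: "r * (\<kappa> * n) \<le> real k"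
    and graphs: "real (card {W. W \<subseteq> Zn n \<times> {1..r} \<and> card W \<le> k}) \<le> 2 powr (n / 100)"
  shows "real (card {f \<in> rainbow_free_colorings r A n.
      3 \<le> card {c \<in> {1..r}. \<kappa> * n \<le> real (card {x \<in> A. f x = c})}})
    \<le> 2 ^ r * (r * (2 powr (935 / 1000 * n) + n * 2 powr (96 / 100 * n + 1)) * 2 powr (n / 100))"
    (is "real (card ?F) \<le> 2 ^ r * (?b * _)")
proof -
  define big where "big f = {c \<in> {1..r}. \<kappa> * n \<le> real (card {x \<in> A. f x = c})}" for f :: "nat \<Rightarrow> nat"
  define Ts where "Ts = {T. T \<subseteq> {1..r} \<and> 3 \<le> card T}"
  define FT where "FT T = {f \<in> A \<rightarrow>\<^sub>E T. rainbow_free n A f \<and>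
      (\<forall>c\<in>T. \<kappa> * n \<le> real (card {x \<in> A. f x = c}))}" for T
  define Ws where "Ws = {W. W \<subseteq> Zn n \<times> {1..r} \<and> card W \<le> k}"
  have fA: "finite A" using A finite_Zn by (rule finite_subset)
  have fin: "finite Ts" "finite Ws" unfolding Ts_def Ws_def
    by (rule finite_subset[of _ "Pow {1..r}"], auto)
      (rule finite_subset[of _ "Pow (Zn n \<times> {1..r})"], auto simp: finite_Zn)
  have finFT: "finite (FT T)" if "T \<in> Ts" for T
    unfolding FT_def using that fA
    by (intro finite_subset[OF _ finite_PiE[of A "\<lambda>_. T"]]) (auto simp: Ts_def finite_subset)
  \<comment> \<open>A colouring is encoded by its set \<open>T\<close> of large colours, its
    recolouring \<open>h\<close>, and its graph \<open>W\<close> on the recoloured points.\<close>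
  have "?F \<subseteq> (\<Union>T\<in>Ts. (\<lambda>(h, W). patch A W h) ` (FT T \<times> Ws))"
  proof
    fix f assume f: "f \<in> ?F"
    define T where "T = big f"
    have T: "T \<in> Ts" using f by (auto simp: T_def Ts_def big_def)
    then have "T \<noteq> {}" by (auto simp: Ts_def)
    then obtain \<beta> where \<beta>: "\<beta> \<in> T" by blast
    have fE: "f \<in> A \<rightarrow>\<^sub>E {1..r}" and rf: "rainbow_free n A f"
      using f by (auto simp: rainbow_free_colorings_def)
    define Q where "Q = {x \<in> A. f x \<notin> T}"
    define h where "h = (\<lambda>x\<in>A. if f x \<in> T then f x else \<beta>)"
    have h: "h \<in> A \<rightarrow>\<^sub>E T" using \<beta> by (auto simp: h_def)
    \<comment> \<open>On \<open>A\<close> the value of \<open>h\<close> depends only on the colour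
      under \<open>f\<close>, so three distinct values of \<open>h\<close> need three distinct
      values of \<open>f\<close>.\<close>
    have h_ne: "f a \<noteq> f b" if "h a \<noteq> h b" "a \<in> A" "b \<in> A" for a b
    proof
      assume "f a = f b"
      then have "h a = h b" using that(2,3) by (simp add: h_def)
      then show False using that(1) by contradiction
    qed
    have "rainbow_free n A h"
      using rf h_ne unfolding rainbow_free_def by metis
    moreover have "\<kappa> * n \<le> real (card {x \<in> A. h x = c})" if c: "c \<in> T" for c
    proof -
      have "{x \<in> A. f x = c} \<subseteq> {x \<in> A. h x = c}" using c by (auto simp: h_def)
      then have "card {x \<in> A. f x = c} \<le> card {x \<in> A. h x = c}" using fA by (intro card_mono) auto
      then show ?thesis using c by (simp add: T_def big_def)
    qed
    ultimately have "h \<in> FT T" using h by (simp add: FT_def)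
    moreover have "(\<lambda>x. (x, f x)) ` Q \<in> Ws"
    proof -
      have "card Q \<le> k"
      proof -
        have "Q \<subseteq> (\<Union>c\<in>{1..r} - T. {x \<in> A. f x = c})" using fE by (auto simp: Q_def)
        then have "card Q \<le> card (\<Union>c\<in>{1..r} - T. {x \<in> A. f x = c})"
          using fA by (intro card_mono) auto
        also have "\<dots> \<le> (\<Sum>c\<in>{1..r} - T. card {x \<in> A. f x = c})" by (rule card_UN_le) simp
        finally have "real (card Q) \<le> (\<Sum>c\<in>{1..r} - T. real (card {x \<in> A. f x = c}))"
          by (simp flip: of_nat_sum)
        also have "\<dots> \<le> (\<Sum>c\<in>{1..r} - T. \<kappa> * n)"
          by (rule sum_mono) (auto simp: T_def big_def)
        also have "\<dots> = card ({1..r} - T) * (\<kappa> * n)" by simp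
        also have "\<dots> \<le> r * (\<kappa> * n)"
        proof (rule mult_right_mono)
          have "card ({1..r} - T) \<le> card {1..r}" by (intro card_mono) auto
          then show "real (card ({1..r} - T)) \<le> real r" by simp
          have "0 \<le> 22 * real (card (Zn n - A) + D)" by simp
          then show "0 \<le> \<kappa> * n" using \<kappa> by linarith
        qed
        finally show ?thesis using k by linarith
      qed
      then have "card ((\<lambda>x. (x, f x)) ` Q) \<le> k"
        using card_image_le[of Q "\<lambda>x. (x, f x)"] fA by (simp add: Q_def)
      moreover have "(\<lambda>x. (x, f x)) ` Q \<subseteq> Zn n \<times> {1..r}" using A fE by (auto simp: Q_def)
      ultimately show ?thesis by (simp add: Ws_def)
    qed
    moreover have "patch A ((\<lambda>x. (x, f x)) ` Q) h = f"
      by (rule patch_graph) (use fE in \<open>auto simp: Q_def h_def PiE_iff\<close>)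
    ultimately show "f \<in> (\<Union>T\<in>Ts. (\<lambda>(h, W). patch A W h) ` (FT T \<times> Ws))"
      using T by (intro UN_I[of T] image_eqI[of _ _ "(h, (\<lambda>x. (x, f x)) ` Q)"]) auto
  qed
  then have "card ?F \<le> card (\<Union>T\<in>Ts. (\<lambda>(h, W). patch A W h) ` (FT T \<times> Ws))"
    using fin finFT by (intro card_mono) auto
  also have "\<dots> \<le> (\<Sum>T\<in>Ts. card ((\<lambda>(h, W). patch A W h) ` (FT T \<times> Ws)))"
    by (rule card_UN_le[OF fin(1)])
  also have "\<dots> \<le> (\<Sum>T\<in>Ts. card (FT T \<times> Ws))"
    using fin finFT by (intro sum_mono card_image_le) auto
  finally have "real (card ?F) \<le> (\<Sum>T\<in>Ts. real (card (FT T)) * real (card Ws))"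
    by (simp add: card_cartesian_product flip: of_nat_sum of_nat_mult)
  also have "\<dots> \<le> (\<Sum>T\<in>Ts. ?b * 2 powr (n / 100))"
  proof (intro sum_mono mult_mono)
    fix T assume T: "T \<in> Ts"
    have "card T \<le> card {1..r}" using T by (intro card_mono) (auto simp: Ts_def)
    then have T': "finite T" "3 \<le> card T" "card T \<le> r" using T by (auto simp: Ts_def finite_subset)
    show "real (card (FT T)) \<le> ?b"
      unfolding FT_def by (rule card_all_big_classes[OF A T' D \<kappa> small])
    show "real (card Ws) \<le> 2 powr (n / 100)" using graphs by (simp add: Ws_def)
  qed auto
  also have "\<dots> = card Ts * (?b * 2 powr (n / 100))" by simp
  also have "\<dots> \<le> 2 ^ r * (?b * 2 powr (n / 100))"
  proof (rule mult_right_mono)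
    have "card Ts \<le> card (Pow {1..r})" by (intro card_mono) (auto simp: Ts_def)
    then have "card Ts \<le> 2 ^ r" by (simp add: card_Pow)
    then show "real (card Ts) \<le> 2 ^ r" by (metis of_nat_le_iff of_nat_numeral of_nat_power)
  qed simp
  finally show ?thesis .
qed

text \<open>If all but few elements have one of two colours, then a single element of a third colour
  makes the two colour classes nearly symmetric about it.\<close>

lemma card_two_big_classes:
  fixes \<kappa> :: real
  assumes A: "A \<subseteq> Zn n" and r: "r \<ge> 3" and \<kappa>: "\<kappa> * n \<ge> 0" and k: "r * (\<kappa> * n) \<le> real k"
    and small: "real (card {E. E \<subseteq> Zn n \<and> card E \<le> card (Zn n - A) + k}) \<le> 2 powr (n / 100)"
    and graphs: "real (card {W. W \<subseteq> Zn n \<times> {1..r} \<and> card W \<le> k}) \<le> 2 powr (n / 100)"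
  shows "real (card {f \<in> rainbow_free_colorings r A n. \<not> card (f ` A) \<le> 2 \<and>
      card {c \<in> {1..r}. \<kappa> * n \<le> real (card {x \<in> A. f x = c})} \<le> 2})
    \<le> (real r)\<^sup>2 * n * 2 powr (52 / 100 * n + 1)"
    (is "real (card ?F) \<le> _")
proof -
  define Ws where "Ws = {W. W \<subseteq> Zn n \<times> {1..r} \<and> card W \<le> k}"
  define Es where "Es = {E. E \<subseteq> Zn n \<and> card E \<le> card (Zn n - A) + k}"
  define Ss where "Ss u = {S. S \<subseteq> Zn n \<and> refl_mod n u ` S \<subseteq> S}" for u
  define dec where "dec B C = (\<lambda>(S, E, W). patch A W (\<lambda>x. if x \<in> S - E then B else C))" for B C :: nat
  define I where "I = ({1..r} \<times> {1..r}) \<times> Zn n"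
  define img where "img = (\<lambda>((B, C), u). dec B C ` (Ss u \<times> Es \<times> Ws))"
  have fA: "finite A" using A finite_Zn by (rule finite_subset)
  have fin: "finite I" "finite Es" "finite (Ss u)" "finite Ws" for u
  proof -
    show "finite I" by (simp add: I_def finite_Zn)
    show "finite Es" unfolding Es_def
      by (rule finite_subset[of _ "Pow (Zn n)"]) (auto simp: finite_Zn)
    show "finite (Ss u)" unfolding Ss_def
      by (rule finite_subset[of _ "Pow (Zn n)"]) (auto simp: finite_Zn)
    show "finite Ws" unfolding Ws_def
      by (rule finite_subset[of _ "Pow (Zn n \<times> {1..r})"]) (auto simp: finite_Zn)
  qed
  have "?F \<subseteq> (\<Union>p\<in>I. img p)"
  proof
    fix f assume f: "f \<in> ?F"
    then have fE: "f \<in> A \<rightarrow>\<^sub>E {1..r}" and rf: "rainbow_free n A f"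
      by (auto simp: rainbow_free_colorings_def)
    define T where "T = {c \<in> {1..r}. \<kappa> * n \<le> real (card {x \<in> A. f x = c})}"
    have T: "T \<subseteq> {1..r}" "card T \<le> 2" using f by (auto simp: T_def)
    \<comment> \<open>With fewer than two large colours, arbitrary ones are added; this can only
      shrink the exceptional set \<open>Q\<close>.\<close>
    obtain T' where T': "T \<subseteq> T'" "T' \<subseteq> {1..r}" "card T' = 2"
      using exists_subset_between[of T 2 "{1..r}"] T r by auto
    then obtain B C where BC: "T' = {B, C}" "B \<noteq> C" by (meson card_2_iff)
    define Q where "Q = {x \<in> A. f x \<notin> {B, C}}"
    have "\<not> f ` A \<subseteq> {B, C}"
    proof
      assume "f ` A \<subseteq> {B, C}"
      then have "card (f ` A) \<le> card {B, C}" by (intro card_mono) auto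
      then show False using f BC(2) by simp
    qed
    then obtain u where u: "u \<in> A" "f u \<noteq> B" "f u \<noteq> C" by auto
    then have uZ: "u \<in> Zn n" "n > 0" using A by (auto simp: Zn_def)
    \<comment> \<open>The symmetric hull about \<open>u\<close> of the class of \<open>B\<close>;
      removing \<open>E\<close> gives the class back. The remaining points of \<open>A\<close>
      outside \<open>Q\<close> have colour \<open>C\<close>, so \<open>S\<close>, \<open>E\<close>
      and the graph on \<open>Q\<close> recover \<open>f\<close>.\<close>
    define S where "S = {x \<in> Zn n. (x \<in> A \<and> f x = B) \<or> (refl_mod n u x \<in> A \<and> f (refl_mod n u x) = B)}"
    define E where "E = {x \<in> S. \<not> (x \<in> A \<and> f x = B)}"
    have Q: "card Q \<le> k"
    proof -
      have "Q \<subseteq> (\<Union>c\<in>{1..r} - T'. {x \<in> A. f x = c})" using fE BC by (auto simp: Q_def)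
      then have "card Q \<le> card (\<Union>c\<in>{1..r} - T'. {x \<in> A. f x = c})"
        using fA by (intro card_mono) auto
      also have "\<dots> \<le> (\<Sum>c\<in>{1..r} - T'. card {x \<in> A. f x = c})" by (rule card_UN_le) simp
      finally have "real (card Q) \<le> (\<Sum>c\<in>{1..r} - T'. real (card {x \<in> A. f x = c}))"
        by (simp flip: of_nat_sum)
      also have "\<dots> \<le> (\<Sum>c\<in>{1..r} - T'. \<kappa> * n)"
        by (rule sum_mono) (use T'(1) in \<open>auto simp: T_def\<close>)
      also have "\<dots> = card ({1..r} - T') * (\<kappa> * n)" by simp
      also have "\<dots> \<le> r * (\<kappa> * n)"
      proof (rule mult_right_mono)
        have "card ({1..r} - T') \<le> card {1..r}" by (intro card_mono) auto
        then show "real (card ({1..r} - T')) \<le> real r" by simp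
      qed (rule \<kappa>)
      finally show ?thesis using k by linarith
    qed
    have "S \<in> Ss u"
      unfolding Ss_def S_def using refl_mod_involution refl_mod_in_Zn[OF uZ(2)] by auto
    moreover have "E \<in> Es"
    proof -
      \<comment> \<open>A point of colour \<open>C\<close> whose mirror image about \<open>u\<close>
        has colour \<open>B\<close> would complete a rainbow progression, as \<open>u\<close> has a
        third colour.\<close>
      have "E \<subseteq> (Zn n - A) \<union> Q"
      proof
        fix x assume x: "x \<in> E"
        show "x \<in> (Zn n - A) \<union> Q"
        proof (rule ccontr)
          assume "x \<notin> (Zn n - A) \<union> Q"
          then have *: "x \<in> A" "f x = C" "refl_mod n u x \<in> A" "f (refl_mod n u x) = B" "x \<in> Zn n"
            using x by (auto simp: E_def S_def Q_def)
          from rainbow_freeD[OF rf three_AP_refl_mod[OF uZ(1) *(5)] *(1) u(1) *(3)]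
          show False using * u BC(2) by simp
        qed
      qed
      then have "card E \<le> card ((Zn n - A) \<union> Q)"
        using fA finite_Zn by (intro card_mono) (auto simp: Q_def)
      also have "\<dots> \<le> card (Zn n - A) + k" using card_Un_le[of "Zn n - A" Q] Q by linarith
      finally show ?thesis by (auto simp: Es_def E_def S_def)
    qed
    moreover have "(\<lambda>x. (x, f x)) ` Q \<in> Ws"
    proof -
      have "card ((\<lambda>x. (x, f x)) ` Q) \<le> k"
        using card_image_le[of Q "\<lambda>x. (x, f x)"] fA Q by (simp add: Q_def)
      moreover have "(\<lambda>x. (x, f x)) ` Q \<subseteq> Zn n \<times> {1..r}" using A fE by (auto simp: Q_def)
      ultimately show ?thesis by (simp add: Ws_def)
    qed
    moreover have "dec B C (S, E, (\<lambda>x. (x, f x)) ` Q) = f"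
      unfolding dec_def prod.case
    proof (rule patch_graph)
      show "f \<in> extensional A" using fE by (simp add: PiE_iff)
      fix x assume "x \<in> A - Q"
      then show "(if x \<in> S - E then B else C) = f x"
        using A by (auto simp: S_def E_def Q_def)
    qed
    moreover have "((B, C), u) \<in> I" using T'(2) BC uZ by (auto simp: I_def)
    ultimately have "f \<in> img ((B, C), u)"
      unfolding img_def prod.case by (intro image_eqI[of _ _ "(S, E, (\<lambda>x. (x, f x)) ` Q)"]) simp_all
    then show "f \<in> (\<Union>p\<in>I. img p)" using \<open>((B, C), u) \<in> I\<close> by blast
  qed
  moreover have "finite (img p)" for p using fin by (auto simp: img_def split: prod.split)
  ultimately have "card ?F \<le> card (\<Union>p\<in>I. img p)"
    using fin(1) by (intro card_mono) auto
  also have "\<dots> \<le> (\<Sum>p\<in>I. card (img p))"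
    by (rule card_UN_le[OF fin(1)])
  finally have "real (card ?F) \<le> (\<Sum>p\<in>I. real (card (img p)))"
    by (simp flip: of_nat_sum)
  also have "\<dots> \<le> (\<Sum>p\<in>I. 2 powr (52 / 100 * n + 1))"
  proof (rule sum_mono)
    fix p assume "p \<in> I"
    then obtain B C u where p: "p = ((B, C), u)" "u \<in> Zn n" by (auto simp: I_def)
    have "card (dec B C ` (Ss u \<times> Es \<times> Ws)) \<le> card (Ss u \<times> Es \<times> Ws)"
      using fin by (intro card_image_le) auto
    then have "real (card (dec B C ` (Ss u \<times> Es \<times> Ws))) \<le> real (card (Ss u)) * (real (card Es) * real (card Ws))"
      by (simp add: card_cartesian_product flip: of_nat_mult)
    also have "\<dots> \<le> 2 powr (n / 2 + 1) * (2 powr (n / 100) * 2 powr (n / 100))"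
      using card_symmetric_subsets[OF p(2)] small graphs
      by (intro mult_mono) (auto simp: Ss_def Es_def Ws_def)
    also have "\<dots> = 2 powr (52 / 100 * n + 1)" by (simp add: algebra_simps flip: powr_add)
    finally show "real (card (img p)) \<le> 2 powr (52 / 100 * n + 1)"
      by (simp add: p img_def)
  qed
  also have "\<dots> = (real r)\<^sup>2 * n * 2 powr (52 / 100 * n + 1)"
    by (simp add: I_def card_cartesian_product card_Zn power2_eq_square)
  finally show ?thesis .
qed

section \<open>Absorbing linear factors and fixing the constants\<close>

lemma eventually_linear_le_exponential:
  fixes K a :: real
  assumes "a > 0"
  shows "\<exists>N. \<forall>n\<ge>N. K * real n \<le> 2 powr (a * n)"
proof -
  \<comment> \<open>This makes \<open>2 powr (a * n)\<close> the square of
    \<open>exp (b * n)\<close>, hence at least \<open>(b * n)\<^sup>2\<close>, where one of the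
    factors \<open>n\<close> beats \<open>K / b\<^sup>2\<close>.\<close>
  define b where "b = a * ln 2 / 2"
  have b: "b > 0" using assms by (simp add: b_def)
  have "K * n \<le> 2 powr (a * n)" if n: "n \<ge> nat \<lceil>K / b\<^sup>2\<rceil>" for n :: nat
  proof -
    have "K / b\<^sup>2 \<le> n" using n by linarith
    then have "K \<le> b\<^sup>2 * n" using b by (simp add: field_simps)
    then have "K * n \<le> b\<^sup>2 * n * n" by (rule mult_right_mono) simp
    also have "\<dots> = (b * n)\<^sup>2" by (simp add: power2_eq_square)
    also have "\<dots> \<le> (exp (b * n))\<^sup>2"
    proof (rule power_mono)
      show "b * n \<le> exp (b * n)" using exp_ge_add_one_self[of "b * n"] by linarith
    qed (use b in simp)
    also have "\<dots> = 2 powr (a * n)" by (simp add: powr_def b_def field_simps flip: exp_double)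
    finally show ?thesis .
  qed
  then show ?thesis by blast
qed

text \<open>Split by whether at least three colours are large. Both cases are bounded by a linear
  factor times \<open>2^(0.97 n)\<close>, and a further \<open>2^(0.02 n)\<close> absorbs the linear
  factors.\<close>

lemma few_colorings_with_three_colors:
  assumes r: "r \<ge> 3"
  shows "\<exists>\<epsilon>>0. \<exists>N. \<forall>n\<ge>N. \<forall>A. A \<subseteq> Zn n \<longrightarrow> real (card (Zn n - A)) \<le> \<epsilon> * n \<longrightarrow>
    real (card {f \<in> rainbow_free_colorings r A n. \<not> card (f ` A) \<le> 2}) \<le> 2 powr (99 / 100 * n)"
proof -
  obtain \<theta>1 :: real where \<theta>1: "\<theta>1 > 0" "\<forall>n::nat. \<forall>(X::nat set) m. finite X \<longrightarrow> real (card X) \<le> 1 * n \<longrightarrow>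
      real m \<le> \<theta>1 * n \<longrightarrow> real (card {S. S \<subseteq> X \<and> card S \<le> m}) \<le> 2 powr (1 / 100 * n)"
    using card_small_subsets_subexponential[where ?'a = nat, of "1 / 100" 1] by auto
  obtain \<theta>2 :: real where \<theta>2: "\<theta>2 > 0" "\<forall>n::nat. \<forall>(X::(nat \<times> nat) set) m. finite X \<longrightarrow> real (card X) \<le> r * n \<longrightarrow>
      real m \<le> \<theta>2 * n \<longrightarrow> real (card {S. S \<subseteq> X \<and> card S \<le> m}) \<le> 2 powr (1 / 100 * n)"
    using card_small_subsets_subexponential[where ?'a = "nat \<times> nat", of "1 / 100" r] by auto
  define \<theta> where "\<theta> = min \<theta>1 \<theta>2"
  \<comment> \<open>All small classes together then cover at most
    \<open>r * \<kappa> * n = \<theta> / 2 * n\<close> points, within reach of the subset counts.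
    The 44 in \<open>\<epsilon>\<close> is twice the required 22: half of
    \<open>\<kappa> * n\<close> is for the missing residues, half for \<open>D\<close>.\<close>
  define \<kappa> where "\<kappa> = \<theta> / (2 * r)"
  define \<epsilon> where "\<epsilon> = \<kappa> / 44"
  define D where "D = 40 * r"
  have \<theta>: "\<theta> > 0" "\<theta> \<le> \<theta>1" "\<theta> \<le> \<theta>2" using \<theta>1(1) \<theta>2(1) by (auto simp: \<theta>_def)
  have \<kappa>: "\<kappa> > 0" "6 * \<kappa> \<le> \<theta>" using \<theta>(1) r by (auto simp: \<kappa>_def field_simps)
  have \<epsilon>: "\<epsilon> > 0" using \<kappa> by (simp add: \<epsilon>_def)
  obtain N1 where N1: "\<forall>n\<ge>N1. (2 * ((real r)\<^sup>2 + 3 * real r * 2 ^ r)) * real n \<le> 2 powr (2 / 100 * n)"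
    using eventually_linear_le_exponential[of "2 / 100"] by auto
  define N where "N = max N1 (nat \<lceil>44 * D / \<kappa>\<rceil> + nat \<lceil>8 / \<theta>\<rceil> + 1)"
  have "real (card {f \<in> rainbow_free_colorings r A n. \<not> card (f ` A) \<le> 2}) \<le> 2 powr (99 / 100 * n)"
    if n: "n \<ge> N" and A: "A \<subseteq> Zn n" and e: "real (card (Zn n - A)) \<le> \<epsilon> * n" for n A
  proof -
    have "real n \<ge> 44 * D / \<kappa>" "real n \<ge> 8 / \<theta>" "n \<ge> N1" "n \<ge> 1"
      using n unfolding N_def by linarith+
    then have nD: "44 * D \<le> \<kappa> * n" and n8: "8 \<le> \<theta> * n" using \<kappa>(1) \<theta>(1) by (simp_all add: field_simps)
    have \<kappa>n: "0 \<le> \<kappa> * n" "6 * (\<kappa> * n) \<le> \<theta> * n"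
      using \<kappa> mult_right_mono[OF \<kappa>(2), of "real n"] by auto
    have e': "44 * real (card (Zn n - A)) \<le> \<kappa> * n" using e by (simp add: \<epsilon>_def)
    define k where "k = nat \<lceil>\<theta> * n / 2\<rceil>"
    have k: "\<theta> * n / 2 \<le> k" "real k \<le> \<theta> * n / 2 + 1" unfolding k_def using n8 by linarith+
    have rk: "r * (\<kappa> * n) \<le> real k" using k(1) r by (simp add: \<kappa>_def)
    have \<theta>n: "\<theta> * n \<le> \<theta>1 * n" "\<theta> * n \<le> \<theta>2 * n" using \<theta> by (auto intro!: mult_right_mono)
    have E: "real (card {E. E \<subseteq> Zn n \<and> card E \<le> m}) \<le> 2 powr (n / 100)" if "real m \<le> \<theta> * n" for m
      using \<theta>1(2)[rule_format, of "Zn n" n m] that \<theta>n(1) by (simp add: finite_Zn card_Zn)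
    have W: "real (card {W. W \<subseteq> Zn n \<times> {1..r} \<and> card W \<le> k}) \<le> 2 powr (n / 100)"
      using \<theta>2(2)[rule_format, of "Zn n \<times> {1..r}" n k] k(2) n8 \<theta>n(2)
      by (simp add: finite_Zn card_Zn card_cartesian_product)
    have \<kappa>D: "22 * real (card (Zn n - A) + D) \<le> \<kappa> * n" using e' nD by simp
    let ?big = "\<lambda>f. {c \<in> {1..r}. \<kappa> * n \<le> real (card {x \<in> A. f x = c})}"
    let ?F = "{f \<in> rainbow_free_colorings r A n. \<not> card (f ` A) \<le> 2}"
    let ?F1 = "{f \<in> rainbow_free_colorings r A n. 3 \<le> card (?big f)}"
    let ?F2 = "{f \<in> rainbow_free_colorings r A n. \<not> card (f ` A) \<le> 2 \<and> card (?big f) \<le> 2}"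
    have "finite (rainbow_free_colorings r A n)"
      unfolding rainbow_free_colorings_def
      by (rule finite_subset[of _ "A \<rightarrow>\<^sub>E {1..r}"])
        (use finite_subset[OF A finite_Zn] in \<open>auto intro!: finite_PiE\<close>)
    then have "card ?F \<le> card (?F1 \<union> ?F2)" by (intro card_mono) auto
    then have "real (card ?F) \<le> real (card ?F1) + real (card ?F2)"
      using card_Un_le[of ?F1 ?F2] by linarith
    also have "real (card ?F1) \<le>
        2 ^ r * (r * (2 powr (935 / 1000 * n) + n * 2 powr (96 / 100 * n + 1)) * 2 powr (n / 100))"
    proof (rule card_three_big_classes[OF A _ \<kappa>D _ rk W])
      show "real (card {E. E \<subseteq> Zn n \<and> card E \<le> card (Zn n - A) + D}) \<le> 2 powr (n / 100)"
      proof (rule E)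
        have "real (card (Zn n - A) + D) \<le> 22 * real (card (Zn n - A) + D)" by simp
        also have "\<dots> \<le> 6 * (\<kappa> * n)" using \<kappa>D \<kappa>n(1) by linarith
        finally show "real (card (Zn n - A) + D) \<le> \<theta> * n" using \<kappa>n(2) by linarith
      qed
    qed (simp add: D_def)
    also have "\<dots> \<le> 2 ^ r * (r * (n * 2 powr (96 / 100 * n) + n * 2 powr (96 / 100 * n + 1)) * 2 powr (n / 100))"
    proof -
      have "1 * 2 powr (935 / 1000 * n) \<le> n * 2 powr (96 / 100 * n)"
        using \<open>n \<ge> 1\<close> by (intro mult_mono) auto
      then show ?thesis by (intro mult_left_mono mult_right_mono add_right_mono) auto
    qed
    also have "\<dots> = 3 * real r * 2 ^ r * n * (2 powr (96 / 100 * n) * 2 powr (n / 100))"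
      by (simp add: powr_add algebra_simps)
    also have "2 powr (96 / 100 * n) * 2 powr (n / 100) = 2 powr (97 / 100 * n)"
      by (simp add: algebra_simps flip: powr_add)
    also have "real (card ?F2) \<le> (real r)\<^sup>2 * n * 2 powr (52 / 100 * n + 1)"
    proof (rule card_two_big_classes[OF A r \<kappa>n(1) rk _ W])
      show "real (card {E. E \<subseteq> Zn n \<and> card E \<le> card (Zn n - A) + k}) \<le> 2 powr (n / 100)"
      proof (rule E)
        have "real (card (Zn n - A)) \<le> \<theta> * n / 8" using e' \<kappa>n by linarith
        then show "real (card (Zn n - A) + k) \<le> \<theta> * n" using k(2) n8 by simp
      qed
    qed
    also have "\<dots> \<le> 2 * (real r)\<^sup>2 * n * 2 powr (97 / 100 * n)"
      by (simp add: powr_add mult_left_mono)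
    finally have "real (card ?F) \<le> 3 * real r * 2 ^ r * n * 2 powr (97 / 100 * n) + 2 * (real r)\<^sup>2 * n * 2 powr (97 / 100 * n)"
      by simp
    also have "\<dots> = ((2 * (real r)\<^sup>2 + 3 * real r * 2 ^ r) * n) * 2 powr (97 / 100 * n)" by (simp add: algebra_simps)
    also have "\<dots> \<le> 2 powr (2 / 100 * n) * 2 powr (97 / 100 * n)"
    proof (rule mult_right_mono)
      have "(2 * (real r)\<^sup>2 + 3 * real r * 2 ^ r) * real n \<le> (2 * ((real r)\<^sup>2 + 3 * real r * 2 ^ r)) * real n"
        by (intro mult_right_mono) auto
      then show "(2 * (real r)\<^sup>2 + 3 * real r * 2 ^ r) * real n \<le> 2 powr (2 / 100 * n)"
        using N1 \<open>n \<ge> N1\<close> by fastforce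
    qed simp
    also have "\<dots> = 2 powr (99 / 100 * n)" by (simp add: algebra_simps flip: powr_add)
    finally show ?thesis .
  qed
  then show ?thesis using \<epsilon> by blast
qed

section \<open>Colourings with two colours and conclusion\<close>

lemma card_colorings_with_two_colors_le:
  assumes "finite A" "r \<ge> 2"
  shows "card {f \<in> A \<rightarrow>\<^sub>E {1..r}. card (f ` A) \<le> 2} \<le> (r choose 2) * 2 ^ card A"
proof -
  define Ps where "Ps = {P. P \<subseteq> {1..r} \<and> card P = 2}"
  have Ps: "finite Ps" "card Ps = r choose 2"
    using n_subsets[of "{1..r}" 2] by (simp_all add: Ps_def)
  have "{f \<in> A \<rightarrow>\<^sub>E {1..r}. card (f ` A) \<le> 2} \<subseteq> (\<Union>P\<in>Ps. A \<rightarrow>\<^sub>E P)"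
  proof
    fix f assume f: "f \<in> {f \<in> A \<rightarrow>\<^sub>E {1..r}. card (f ` A) \<le> 2}"
    then have "f ` A \<subseteq> {1..r}" by auto
    then obtain P where P: "f ` A \<subseteq> P" "P \<subseteq> {1..r}" "card P = 2"
      using exists_subset_between[of "f ` A" 2 "{1..r}"] f assms(2) by auto
    then have "f \<in> A \<rightarrow>\<^sub>E P" using f by (auto simp: PiE_iff)
    then show "f \<in> (\<Union>P\<in>Ps. A \<rightarrow>\<^sub>E P)" using P by (auto simp: Ps_def)
  qed
  moreover have finP: "finite P" if "P \<in> Ps" for P
    using that finite_subset by (auto simp: Ps_def)
  ultimately have "card {f \<in> A \<rightarrow>\<^sub>E {1..r}. card (f ` A) \<le> 2} \<le> card (\<Union>P\<in>Ps. A \<rightarrow>\<^sub>E P)"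
    using Ps(1) assms(1) by (intro card_mono) (auto intro!: finite_PiE)
  also have "\<dots> \<le> (\<Sum>P\<in>Ps. card (A \<rightarrow>\<^sub>E P))" by (rule card_UN_le[OF Ps(1)])
  also have "\<dots> = (\<Sum>P\<in>Ps. 2 ^ card A)"
    using assms(1) by (intro sum.cong refl) (simp add: card_PiE Ps_def)
  also have "\<dots> = (r choose 2) * 2 ^ card A" using Ps(2) by simp
  finally show ?thesis .
qed

text \<open>Every pair of colours has \<open>2 ^ card A - 2\<close> colourings using both, and there
  are \<open>r\<close> constant ones; all these families are disjoint. The subtraction does not
  truncate, as \<open>A\<close> is nonempty.\<close>

lemma card_colorings_with_two_colors_ge:
  assumes "finite A" "A \<noteq> {}"
  shows "(r choose 2) * (2 ^ card A - 2) + r \<le> card {f \<in> A \<rightarrow>\<^sub>E {1..r}. card (f ` A) \<le> 2}"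
proof -
  define Ps where "Ps = {P. P \<subseteq> {1..r} \<and> card P = 2}"
  have Ps: "finite Ps" "card Ps = r choose 2"
    using n_subsets[of "{1..r}" 2] by (simp_all add: Ps_def)
  have finP: "finite P" if "P \<in> Ps" for P
    using that finite_subset by (auto simp: Ps_def)
  define X where "X P = {f \<in> A \<rightarrow>\<^sub>E P. f ` A = P}" for P :: "nat set"
  define K where "K = (\<lambda>c. \<lambda>x\<in>A. c) ` {1..r}"
  have finX: "finite (X P)" if "P \<in> Ps" for P
    unfolding X_def using finite_PiE[OF assms(1), of "\<lambda>_. P"] finP[OF that] by simp
  have X: "2 ^ card A - 2 \<le> card (X P)" if P: "P \<in> Ps" for P
  proof -
    let ?C = "\<Union>c\<in>P. A \<rightarrow>\<^sub>E {c}"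
    have "card ?C \<le> (\<Sum>c\<in>P. card (A \<rightarrow>\<^sub>E {c}))" by (rule card_UN_le[OF finP[OF P]])
    also have "\<dots> = 2" using assms(1) P by (simp add: card_PiE Ps_def)
    finally have C: "card ?C \<le> 2" .
    have "(A \<rightarrow>\<^sub>E P) - ?C \<subseteq> X P"
    proof
      fix f assume f: "f \<in> (A \<rightarrow>\<^sub>E P) - ?C"
      have sub: "f ` A \<subseteq> P" using f by auto
      have "card (f ` A) \<noteq> 0" using assms by simp
      moreover have "card (f ` A) \<noteq> 1"
      proof
        assume "card (f ` A) = 1"
        then obtain c where c: "f ` A = {c}" by (auto simp: card_1_singleton_iff)
        have "f x = c" if "x \<in> A" for x using c that by blast
        moreover have "f x = undefined" if "x \<notin> A" for x using f that by (auto intro: PiE_arb)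
        ultimately have "f \<in> A \<rightarrow>\<^sub>E {c}" by (intro PiE_I) auto
        moreover have "c \<in> P" using c sub by blast
        ultimately show False using f by blast
      qed
      ultimately have "card P \<le> card (f ` A)" using P by (simp add: Ps_def)
      then have "f ` A = P" using sub finP[OF P] by (metis card_seteq)
      then show "f \<in> X P" using f by (simp add: X_def)
    qed
    then have "card ((A \<rightarrow>\<^sub>E P) - ?C) \<le> card (X P)" by (rule card_mono[OF finX[OF P]])
    moreover have "card (A \<rightarrow>\<^sub>E P) - card ?C \<le> card ((A \<rightarrow>\<^sub>E P) - ?C)"
      using finP[OF P] assms(1) by (intro diff_card_le_card_Diff) (auto intro!: finite_PiE)
    moreover have "card (A \<rightarrow>\<^sub>E P) = 2 ^ card A" using assms(1) P by (simp add: card_PiE Ps_def)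
    ultimately show ?thesis using C by linarith
  qed
  have K: "card K = r"
  proof -
    obtain a where "a \<in> A" using assms(2) by blast
    then have "inj_on (\<lambda>c. \<lambda>x\<in>A. c) {1..r}"
      by (intro inj_onI) (metis restrict_apply')
    then show ?thesis by (simp add: K_def card_image)
  qed
  have K1: "card (f ` A) = 1" if f: "f \<in> K" for f
  proof -
    obtain c where "f = (\<lambda>x\<in>A. c)" using f by (auto simp: K_def)
    then have "f ` A = {c}" using assms(2) by auto
    then show ?thesis by simp
  qed
  have "(r choose 2) * (2 ^ card A - 2) = (\<Sum>P\<in>Ps. 2 ^ card A - 2)" using Ps(2) by simp
  also have "\<dots> \<le> (\<Sum>P\<in>Ps. card (X P))" by (rule sum_mono[OF X])
  also have "\<dots> = card (\<Union>P\<in>Ps. X P)"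
    by (rule card_UN_disjoint[symmetric]) (use Ps finX in \<open>auto simp: X_def\<close>)
  finally have "(r choose 2) * (2 ^ card A - 2) + r \<le> card (\<Union>P\<in>Ps. X P) + card K" using K by simp
  also have "\<dots> = card ((\<Union>P\<in>Ps. X P) \<union> K)"
  proof (rule card_Un_disjoint[symmetric])
    show "(\<Union>P\<in>Ps. X P) \<inter> K = {}" using K1 by (fastforce simp: X_def Ps_def)
  qed (use Ps finX in \<open>auto simp: K_def\<close>)
  also have "\<dots> \<le> card {f \<in> A \<rightarrow>\<^sub>E {1..r}. card (f ` A) \<le> 2}"
  proof (rule card_mono)
    have "finite (A \<rightarrow>\<^sub>E {1..r})" using assms(1) by (intro finite_PiE) auto
    then show "finite {f \<in> A \<rightarrow>\<^sub>E {1..r}. card (f ` A) \<le> 2}" by simp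
    have "f \<in> A \<rightarrow>\<^sub>E {1..r} \<and> card (f ` A) \<le> 2" if "f \<in> X P" "P \<in> Ps" for f P
      using that by (auto simp: X_def Ps_def PiE_iff)
    moreover have "f \<in> A \<rightarrow>\<^sub>E {1..r} \<and> card (f ` A) \<le> 2" if "f \<in> K" for f
      using that K1[OF that] by (auto simp: K_def)
    ultimately show "(\<Union>P\<in>Ps. X P) \<union> K \<subseteq> {f \<in> A \<rightarrow>\<^sub>E {1..r}. card (f ` A) \<le> 2}" by blast
  qed
  finally show ?thesis .
qed

lemma rainbow_free_if_two_colors:
  assumes "finite A" "card (f ` A) \<le> 2"
  shows "rainbow_free n A f"
  unfolding rainbow_free_def
proof clarify
  fix a b c assume abc: "a \<in> A" "b \<in> A" "c \<in> A" "f a \<noteq> f b" "f b \<noteq> f c" "f a \<noteq> f c"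
  have "card {f a, f b, f c} \<le> card (f ` A)" using abc(1-3) assms(1) by (intro card_mono) auto
  then show False using abc(4-6) assms(2) by simp
qed

lemma g_eq_two_colors_plus_rest:
  assumes "finite A"
  shows "g r A n = card {f \<in> A \<rightarrow>\<^sub>E {1..r}. card (f ` A) \<le> 2} +
    card {f \<in> rainbow_free_colorings r A n. \<not> card (f ` A) \<le> 2}"
proof -
  let ?X = "{f \<in> A \<rightarrow>\<^sub>E {1..r}. card (f ` A) \<le> 2}"
  let ?Y = "{f \<in> rainbow_free_colorings r A n. \<not> card (f ` A) \<le> 2}"
  have fin: "finite (A \<rightarrow>\<^sub>E {1..r})" using assms by (intro finite_PiE) auto
  have "rainbow_free_colorings r A n = ?X \<union> ?Y"
    using rainbow_free_if_two_colors[OF assms] by (auto simp: rainbow_free_colorings_def)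
  then have "g r A n = card (?X \<union> ?Y)" by (simp only: g_def)
  also have "\<dots> = card ?X + card ?Y"
    by (rule card_Un_disjoint) (use fin in \<open>auto simp: rainbow_free_colorings_def\<close>)
  finally show ?thesis .
qed

text \<open>For large \<open>n\<close> at most \<open>2 powr (99 / 100 * n)\<close> rainbow-free
  colourings use three or more colours. This exponential saving beats the stated error term and also
  gives the limit.\<close>

theorem corollary1p5:
  fixes r :: nat
  assumes "r \<ge> 3"
  shows "(\<exists>N::nat. \<forall>n\<ge>N.
            real (r choose 2) * 2 ^ n - (real r)\<^sup>2 + 2 * real r \<le> real (g r (Zn n) n) \<and>
            real (g r (Zn n) n) \<le>
              real (r choose 2) * 2 ^ n + 2 powr (- (real n / (36 * log 2 (real n)))) * 2 ^ n \<and>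
            (\<forall>A. A \<subset> Zn n \<longrightarrow> g r A n < g r (Zn n) n)) \<and>
         (\<lambda>n. real (card {f \<in> rainbow_free_colorings r (Zn n) n. \<not> card (f ` Zn n) \<le> 2}) /
              real (g r (Zn n) n)) \<longlonglongrightarrow> 0"
proof -
  define C where "C = real (r choose 2)"
  define three where "three A n = {f \<in> rainbow_free_colorings r A n. \<not> card (f ` A) \<le> 2}" for A n
  obtain \<epsilon> N1 where \<epsilon>: "\<epsilon> > 0" and
    N1: "\<forall>n\<ge>N1. \<forall>A. A \<subseteq> Zn n \<longrightarrow> real (card (Zn n - A)) \<le> \<epsilon> * n \<longrightarrow>
      real (card (three A n)) \<le> 2 powr (99 / 100 * n)"
    using few_colorings_with_three_colors[OF assms] unfolding three_def by blast
  obtain N2 where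
    N2: "\<forall>n\<ge>N2. \<forall>A. A \<subseteq> Zn n \<longrightarrow> real (card A) \<le> (1 - \<epsilon>) * n \<longrightarrow> real (g r A n) < 2 ^ n"
    using colorings_of_sparse_set[OF \<epsilon> assms] by blast
  \<comment> \<open>From \<open>n \<ge> 100\<close> follows \<open>99 / 100 * n \<le> n - 1\<close>,
    and \<open>r\<^sup>2 \<le> n\<close> makes the correction \<open>r\<^sup>2\<close> smaller than
    \<open>2 ^ n\<close>.\<close>
  define N where "N = max (max N1 N2) (r\<^sup>2 + 100)"
  have "even (r * (r - 1))" by (cases r) auto
  then have "2 * (r choose 2) = r * (r - 1)" unfolding choose_two by (rule dvd_mult_div_cancel)
  then have C2: "2 * C = real (r * (r - 1))" unfolding C_def by (metis of_nat_mult of_nat_numeral)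
  have "3 * 2 \<le> r * (r - 1)" using assms by (intro mult_le_mono) auto
  then have "real 6 \<le> real (r * (r - 1))" by (intro of_nat_mono) simp
  then have C3: "C \<ge> 3" using C2 by linarith
  have C: "2 * C = (real r)\<^sup>2 - real r"
    using assms C2 by (simp add: of_nat_diff power2_eq_square algebra_simps)
  have lower: "C * 2 ^ n - (real r)\<^sup>2 + 2 * real r \<le> real (g r (Zn n) n)" if n: "n \<ge> 1" for n
  proof -
    have "(2::nat) \<le> 2 ^ n" using n by (metis power_increasing power_one_right one_le_numeral)
    then have "real ((r choose 2) * (2 ^ n - 2) + r) = C * (2 ^ n - 2) + r"
      by (simp add: C_def of_nat_diff)
    moreover have "Zn n \<noteq> {}" using n by (simp add: Zn_def)
    then have "(r choose 2) * (2 ^ n - 2) + r \<le> g r (Zn n) n"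
      using card_colorings_with_two_colors_ge[of "Zn n" r] g_eq_two_colors_plus_rest[of "Zn n" r n]
      by (simp add: finite_Zn card_Zn)
    ultimately have "C * (2 ^ n - 2) + r \<le> real (g r (Zn n) n)" by (metis of_nat_mono)
    \<comment> \<open>The identity \<open>2 * C = r\<^sup>2 - r\<close> turns
      \<open>- 2 * C + r\<close> into the stated correction.\<close>
    then show ?thesis using C by (simp add: algebra_simps)
  qed
  have upper: "real (g r A n) \<le> C * 2 ^ card A + 2 powr (99 / 100 * n)"
    if "n \<ge> N1" "A \<subseteq> Zn n" "real (card (Zn n - A)) \<le> \<epsilon> * n" for n A
  proof -
    have fA: "finite A" using that(2) finite_Zn by (rule finite_subset)
    have "r \<ge> 2" using assms by simp
    have "real (card {f \<in> A \<rightarrow>\<^sub>E {1..r}. card (f ` A) \<le> 2}) \<le> real ((r choose 2) * 2 ^ card A)"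
      using card_colorings_with_two_colors_le[OF fA \<open>r \<ge> 2\<close>] by (rule of_nat_mono)
    also have "\<dots> = C * 2 ^ card A" by (simp add: C_def)
    finally have "real (card {f \<in> A \<rightarrow>\<^sub>E {1..r}. card (f ` A) \<le> 2}) \<le> C * 2 ^ card A" .
    moreover have "real (card (three A n)) \<le> 2 powr (99 / 100 * n)"
      using N1[rule_format, OF that] .
    ultimately show ?thesis
      unfolding g_eq_two_colors_plus_rest[OF fA] of_nat_add three_def by linarith
  qed
  have large: "2 ^ n < real (g r (Zn n) n)" "2 powr (99 / 100 * n) + (real r)\<^sup>2 < 2 * 2 ^ (n - 1) + 2 ^ (n - 1)"
    "2 powr (99 / 100 * n) \<le> 2 ^ (n - 1)" "2 ^ n = 2 * (2 ^ (n - 1) :: real)"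
    if n: "n \<ge> N" for n
  proof -
    have n': "n \<ge> 100" "r\<^sup>2 \<le> n" using n by (auto simp: N_def)
    show e: "2 ^ n = 2 * (2 ^ (n - 1) :: real)" using n' by (cases n) auto
    have "(real r)\<^sup>2 \<le> n" using n'(2) by (metis of_nat_mono of_nat_power)
    also have "real n < 2 ^ n" by (rule of_nat_less_two_power)
    finally have r2: "(real r)\<^sup>2 < 2 ^ n" .
    have "2 powr (99 / 100 * n) \<le> 2 powr (real (n - 1))" using n' by (intro powr_mono) (auto simp: of_nat_diff)
    then show p: "2 powr (99 / 100 * n) \<le> 2 ^ (n - 1)" by (simp add: powr_realpow)
    show "2 powr (99 / 100 * n) + (real r)\<^sup>2 < 2 * 2 ^ (n - 1) + 2 ^ (n - 1)" using p r2 e by linarith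
    have "3 * 2 ^ n \<le> C * 2 ^ n" using C3 by (intro mult_right_mono) auto
    moreover have "real r > 0" using assms by simp
    ultimately show "2 ^ n < real (g r (Zn n) n)" using lower[of n] r2 n' by linarith
  qed
  have part1: "C * 2 ^ n - (real r)\<^sup>2 + 2 * real r \<le> real (g r (Zn n) n) \<and>
      real (g r (Zn n) n) \<le> C * 2 ^ n + 2 powr (- (real n / (36 * log 2 (real n)))) * 2 ^ n \<and>
      (\<forall>A. A \<subset> Zn n \<longrightarrow> g r A n < g r (Zn n) n)" if n: "n \<ge> N" for n
  proof (intro conjI allI impI)
    have n': "n \<ge> 100" "n \<ge> N1" "n \<ge> N2" using n by (auto simp: N_def)
    show lo: "C * 2 ^ n - (real r)\<^sup>2 + 2 * real r \<le> real (g r (Zn n) n)" using lower n' by simp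
    \<comment> \<open>Already \<open>n \<ge> 16\<close> gives \<open>36 * log 2 n \<ge> 144\<close>,
      so the stated error term exceeds \<open>2 powr (99 / 100 * n)\<close>.\<close>
    have "log 2 16 \<le> log 2 n" using n' by (subst log_le_cancel_iff) auto
    moreover have "log 2 16 = 4" using log_pow_cancel[of 2 4] by simp
    ultimately have l: "36 * log 2 n \<ge> 100" by linarith
    then have "real n / (36 * log 2 n) \<le> n / 100" by (intro divide_left_mono) auto
    then have "2 powr (99 / 100 * n) \<le> 2 powr (- (real n / (36 * log 2 n)) + n)" by (intro powr_mono) auto
    also have "\<dots> = 2 powr (- (real n / (36 * log 2 n))) * 2 ^ n" by (simp only: powr_add) (simp add: powr_realpow)
    finally show "real (g r (Zn n) n) \<le> C * 2 ^ n + 2 powr (- (real n / (36 * log 2 (real n)))) * 2 ^ n"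
      using upper[of n "Zn n"] n' \<epsilon> by (simp add: card_Zn)
    fix A assume A: "A \<subset> Zn n"
    have "real (g r A n) < real (g r (Zn n) n)"
    \<comment> \<open>If \<open>A\<close> is almost everything, losing a point at least halves the
      main term, and since \<open>C \<ge> 3\<close> the other half exceeds all corrections.
      Otherwise the sparse bound \<open>2 ^ n\<close> already lies below
      \<open>g r (Zn n) n\<close>.\<close>
    proof (cases "real (card (Zn n - A)) \<le> \<epsilon> * n")
      case True
      have "card A < n" using psubset_card_mono[OF finite_Zn A] by (simp add: card_Zn)
      then have "(2::real) ^ card A \<le> 2 ^ (n - 1)" by (intro power_increasing) auto
      then have "C * 2 ^ card A \<le> C * 2 ^ (n - 1)" using C3 by (intro mult_left_mono) auto
      moreover have "real (g r A n) \<le> C * 2 ^ card A + 2 powr (99 / 100 * n)"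
        by (rule upper) (use n' A True in auto)
      ultimately have "real (g r A n) \<le> C * 2 ^ (n - 1) + 2 powr (99 / 100 * n)" by linarith
      moreover have "3 * 2 ^ (n - 1) \<le> C * 2 ^ (n - 1)" using C3 by (intro mult_right_mono) auto
      moreover have "C * 2 ^ n = 2 * (C * 2 ^ (n - 1))" using large(4)[OF n] by simp
      moreover have "real r \<ge> 0" by simp
      ultimately show ?thesis using lo large(2)[OF n] by linarith
    next
      case False
      have "card (Zn n - A) = n - card A" "card A \<le> n"
        using A card_Diff_subset[of A "Zn n"] card_mono[OF finite_Zn, of A n] finite_subset[OF _ finite_Zn]
        by (auto simp: card_Zn)
      then have "real (card A) \<le> (1 - \<epsilon>) * n" using False by (simp add: of_nat_diff algebra_simps)
      then have "real (g r A n) < 2 ^ n" using N2 n' A by auto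
      then show ?thesis using large(1)[OF n] by linarith
    qed
    then show "g r A n < g r (Zn n) n" by simp
  qed
  have "(\<lambda>n. real (card (three (Zn n) n)) / real (g r (Zn n) n)) \<longlonglongrightarrow> 0"
  proof (rule tendsto_sandwich[where f = "\<lambda>_. 0" and h = "\<lambda>n. (2 powr (- 1 / 100)) ^ n"])
    show "(\<lambda>n. (2 powr (- 1 / 100)) ^ n :: real) \<longlonglongrightarrow> 0"
      by (rule LIMSEQ_realpow_zero) (auto intro: powr_less_one)
    show "\<forall>\<^sub>F n in sequentially. 0 \<le> real (card (three (Zn n) n)) / real (g r (Zn n) n)" by simp
    show "\<forall>\<^sub>F n in sequentially. real (card (three (Zn n) n)) / real (g r (Zn n) n) \<le> (2 powr (- 1 / 100)) ^ n"
    proof (rule eventually_sequentiallyI[of N])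
      fix n assume n: "n \<ge> N"
      have "real (card (three (Zn n) n)) \<le> 2 powr (99 / 100 * n)"
        using N1 n \<epsilon> by (auto simp: N_def)
      then have "real (card (three (Zn n) n)) / real (g r (Zn n) n) \<le> 2 powr (99 / 100 * n) / 2 ^ n"
        using large(1)[OF n] by (intro frac_le) auto
      also have "\<dots> = 2 powr (99 / 100 * n - n)" by (simp only: powr_diff) (simp add: powr_realpow)
      also have "\<dots> = (2 powr (- 1 / 100)) ^ n" by (simp add: powr_powr powr_realpow[symmetric])
      finally show "real (card (three (Zn n) n)) / real (g r (Zn n) n) \<le> (2 powr (- 1 / 100)) ^ n" .
    qed
  qed simp
  then show ?thesis using part1 unfolding C_def three_def by blast
qed

end
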